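(* Let $|\cdot|$ denote the Euclidean norm in $\mathbb{R}^K$. Suppose that $\lim_{N\to\infty} N^*/N=\gamma$ and that $Y^N(0)\to y(0)$ in probability as $N\to\infty$, where $y(0)$ is deterministic. Then for every $t_0>0$ and every $\epsilon>0$, $$\lim_{N\to\infty}P\Big(\sup_{t\le t_0}|Y^N(t)-y(t)|>\epsilon\Big)=0,$$ where $y(t)$ is the unique solution, starting at $y(0)$, of the differential equation $\frac{dy}{dt}=f(y)$, and $f$ is the vector field $$f(y)=\sum_{k=0}^{K-1}\left[\frac{\lambda\gamma g_k}{\sum_{i=0}^{K-1}y_ig_i}(\mathbf{1}_{K-1}-\mathbf{1}_k)+\sum_{j=0}^{k}\mu p_{kj}(\mathbf{1}_j-\mathbf{1}_k)\mathbf{1}\{k\ge K_U\}\right]y_k ,$$ or componentwise, for $0\le j\le K-1$, $$f_j(y)=\sum_{k=\max(K_U,j)}^{K-1}\mu p_{kj}y_k+\lambda\gamma\mathbf{1}\{j=K-1\}-\mu y_j\mathbf{1}\{j\ge K_U\}-\frac{\lambda\gamma y_jg_j}{\sum_{i=0}^{K-1}y_ig_i}.$$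
   Context: Fix an integer $K\ge 1$ (number of battery-life intervals), a threshold $K_U\in\{0,\dots,K-1\}$, rates $\lambda,\mu>0$, a decreasing sequence of positive numbers $g_0,\dots,g_{K-1}$, and numbers $p_{ij}\ge 0$ for $0\le j\le i\le K-1$ with $\sum_{j\le i}p_{ij}=1$ for all $i\ge K_U$ (set $p_{ij}=0$ for $j>i$); $p_{ij}$ is the probability that a ride started in battery interval $i$ ends in interval $j$. For each $N\ge1$ (number of e-scooters) let $N^*=N^*(N)\ge 0$ be the number of swappers; $\gamma\ge0$ is a constant. Let $\mathbf{1}_k\in\mathbb{R}^K$ denote the $k$-th standard unit vector ($k=0,\dots,K-1$) and $\mathbf{1}\{\cdot\}$ an indicator. $Y^N(t)=(Y^N_0(t),\dots,Y^N_{K-1}(t))$, $t\ge0$, where $Y_k^N(t)$ is the proportion of the $N$ e-scooters with battery life in the $k$-th interval, is the right-continuous continuous-time Markov jump process on $\{y\in(\tfrac1N\mathbb{Z}_{\ge0})^K:\sum_k y_k=1\}$ with transition rates, for $k,j\in\{0,\dots,K-1\}$, $$Q^N\big(y,y+\tfrac1N(\mathbf{1}_{K-1}-\mathbf{1}_k)\big)=\lambda N^*\frac{y_kg_k}{\sum_{i=0}^{K-1}y_ig_i}\quad(k\ne K-1),$$ $$Q^N\big(y,y+\tfrac1N(\mathbf{1}_j-\mathbf{1}_k)\big)=\mu N p_{kj}y_k\mathbf{1}\{k\ge K_U\}\quad(j<k),$$ and no other jumps. The initial state $Y^N(0)$ may be random. The vector field $f$ is considered for $y\in[0,1]^K$ with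 $\sum_i y_ig_i\neq0$, and solutions $y(t)$ take values in this set. *)

theory Defs
  imports "HOL-Probability.Probability"
begin

section \<open>Finite-state continuous-time Markov jump processes\<close>

text \<open>
  \<open>q x y\<close> is the jump rate from \<open>x\<close> to \<open>y\<close> for \<open>x \<noteq> y\<close>; the values \<open>q x x\<close> are ignored.
  As the state set is finite and \<open>P h x\<close> is a probability distribution, the off-diagonal
  right derivatives at \<open>0\<close> determine the total exit rate as well.
\<close>

definition transition_semigroup_with_rates ::
    "'a set \<Rightarrow> ('a \<Rightarrow> 'a \<Rightarrow> real) \<Rightarrow> (real \<Rightarrow> 'a \<Rightarrow> 'a pmf) \<Rightarrow> bool" where
  "transition_semigroup_with_rates S q P \<longleftrightarrow>
     finite S \<and>
     (\<forall>t\<ge>0. \<forall>x\<in>S. set_pmf (P t x) \<subseteq> S) \<and>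
     (\<forall>x\<in>S. P 0 x = return_pmf x) \<and>
     (\<forall>s\<ge>0. \<forall>t\<ge>0. \<forall>x\<in>S. P (s + t) x = bind_pmf (P s x) (P t)) \<and>
     (\<forall>x\<in>S. \<forall>y\<in>S. x \<noteq> y \<longrightarrow> ((\<lambda>h. pmf (P h x) y / h) \<longlongrightarrow> q x y) (at_right 0))"

definition past :: "'w measure \<Rightarrow> 'a set \<Rightarrow> (real \<Rightarrow> 'w \<Rightarrow> 'a) \<Rightarrow> real \<Rightarrow> 'w measure" where
  "past M S X s = sigma (space M) {X u -` A \<inter> space M | u A. 0 \<le> u \<and> u \<le> s \<and> A \<subseteq> S}"

text \<open>
  Only times \<open>t \<ge> 0\<close> matter, and the law of \<open>X 0\<close> is arbitrary.  In a finite (hence discrete)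
  state set, right-continuity says that the path stays constant for a positive time
  after every instant.
\<close>

definition markov_jump_process ::
    "'w measure \<Rightarrow> 'a::t2_space set \<Rightarrow> ('a \<Rightarrow> 'a \<Rightarrow> real) \<Rightarrow> (real \<Rightarrow> 'w \<Rightarrow> 'a) \<Rightarrow> bool" where
  "markov_jump_process M S q X \<longleftrightarrow>
     prob_space M \<and>
     (\<forall>t\<ge>0. X t \<in> measurable M (count_space S)) \<and>
     (\<forall>\<omega>\<in>space M. \<forall>t\<ge>0. continuous (at_right t) (\<lambda>s. X s \<omega>)) \<and>
     (\<exists>P. transition_semigroup_with_rates S q P \<and>
        (\<forall>s\<ge>0. \<forall>h\<ge>0. \<forall>y\<in>S. AE \<omega> in M.
           real_cond_exp M (past M S X s) (indicator (X (s + h) -` {y} \<inter> space M)) \<omega>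
             = pmf (P h (X s \<omega>)) y))"

section \<open>The e-scooter model\<close>

text \<open>
  The battery intervals \<open>0, \<dots>, K - 1\<close> are the elements of a finite linearly ordered
  type \<open>'k\<close> with \<open>CARD('k) = K\<close>, so that vectors of \<open>K\<close> proportions live in \<open>real ^ 'k\<close>;
  the last interval \<open>K - 1\<close> is the maximum of \<open>'k\<close>.
\<close>

abbreviation last_interval :: "'k::{finite,linorder}" where
  "last_interval \<equiv> Max UNIV"

definition scooter_states :: "nat \<Rightarrow> (real ^ 'k::{finite,linorder}) set" where
  "scooter_states N = {y. (\<forall>k. \<exists>m::nat. y $ k = real m / real N) \<and> (\<Sum>k\<in>UNIV. y $ k) = 1}"

text \<open>
  The jump vectors \<open>axis last_interval 1 - axis k 1\<close> (\<open>k \<noteq> last_interval\<close>) and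
  \<open>axis j 1 - axis k 1\<close> (\<open>j < k\<close>) are nonzero and pairwise distinct, so for \<open>N \<ge> 1\<close> at most
  one summand below is nonzero.
\<close>

definition scooter_rate ::
    "real \<Rightarrow> real \<Rightarrow> 'k::{finite,linorder} \<Rightarrow> ('k \<Rightarrow> real) \<Rightarrow> ('k \<Rightarrow> 'k \<Rightarrow> real) \<Rightarrow> real \<Rightarrow> nat
      \<Rightarrow> real ^ 'k::{finite,linorder} \<Rightarrow> real ^ 'k::{finite,linorder} \<Rightarrow> real" where
  "scooter_rate lam mu KU g p Nst N y y' =
     (\<Sum>k | k \<noteq> last_interval.
        if y' = y + (1 / real N) *\<^sub>R (axis last_interval 1 - axis k 1)
        then lam * Nst * (y $ k * g k) / (\<Sum>i\<in>UNIV. y $ i * g i) else 0)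
   + (\<Sum>k\<in>UNIV. \<Sum>j | j < k.
        if y' = y + (1 / real N) *\<^sub>R (axis j 1 - axis k 1)
        then mu * real N * p k j * y $ k * of_bool (KU \<le> k) else 0)"

definition fluid_domain :: "('k::{finite,linorder} \<Rightarrow> real) \<Rightarrow> (real ^ 'k::{finite,linorder}) set" where
  "fluid_domain g = {y. (\<forall>k. 0 \<le> y $ k \<and> y $ k \<le> 1) \<and> (\<Sum>i\<in>UNIV. y $ i * g i) \<noteq> 0}"

definition fluid_field ::
    "real \<Rightarrow> real \<Rightarrow> 'k::{finite,linorder} \<Rightarrow> ('k \<Rightarrow> real) \<Rightarrow> ('k \<Rightarrow> 'k \<Rightarrow> real) \<Rightarrow> real
      \<Rightarrow> real ^ 'k::{finite,linorder} \<Rightarrow> real ^ 'k::{finite,linorder}" where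
  "fluid_field lam mu KU g p gam y =
     (\<Sum>k\<in>UNIV. y $ k *\<^sub>R
        ((lam * gam * g k / (\<Sum>i\<in>UNIV. y $ i * g i)) *\<^sub>R (axis last_interval 1 - axis k 1)
         + (\<Sum>j\<le>k. (mu * p k j * of_bool (KU \<le> k)) *\<^sub>R (axis j 1 - axis k 1))))"

definition solves_ode_from ::
    "(real ^ 'n::finite \<Rightarrow> real ^ 'n::finite) \<Rightarrow> (real ^ 'n::finite) set \<Rightarrow> real ^ 'n::finite
      \<Rightarrow> (real \<Rightarrow> real ^ 'n::finite) \<Rightarrow> bool" where
  "solves_ode_from f D y0 y \<longleftrightarrow>
     y 0 = y0 \<and>
     (\<forall>t\<ge>0. y t \<in> D \<and> (y has_vector_derivative f (y t)) (at t within {0..}))"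

end

theory Submission
  imports Defs
begin

text \<open>
  On the probability simplex the field \<open>f\<close> is Lipschitz, because \<open>\<Sum>i. y\<^sub>i * g i\<close> is bounded below
  there, and solutions stay in the simplex because \<open>f\<^sub>k(y) + C * y\<^sub>k \<ge> 0\<close> for a constant \<open>C\<close>.
  The drift of \<open>Y\<^sup>N\<close> is \<open>f\<close> with \<open>gam\<close> replaced by \<open>Nst N / N\<close>, and its infinitesimal variance is
  \<open>O(1/N)\<close>.  For a jump process \<open>X\<close> whose drift differs from a Lipschitz field by at most \<open>d\<close> and whose
  infinitesimal variance is at most \<open>v\<close>, the one-step expectation of \<open>|X - y|\<^sup>2\<close> over a small time \<open>h\<close> is
  at most \<open>(1 + 2 * L * h) * |X - y|\<^sup>2 + h * (2 * R * d + v + o(1))\<close>, where \<open>R\<close> bounds \<open>|X - y|\<close>.  Suitably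
  weighted, this squared distance is thus a nonnegative supermartingale along every fine time grid,
  and its maximal inequality bounds the largest deviation on the grid.  Right-continuity
  carries the bound over from the dyadic grids to the supremum over \<open>[0, t\<^sub>0]\<close>.
\<close>

section \<open>Lipschitz differential equations on the half-line\<close>

text \<open>A process is known only through its transition law, and that law only through its right
  derivatives at time 0. Hence no generator martingale is at hand, and a time grid is used, on which
  the Markov property between neighbouring grid times suffices. The \<open>o(1)\<close> of the
  one-step estimate is uniform over states because the state set is finite, but its size depends on
  the fleet. Therefore the mesh tends to 0 for a fixed fleet, which removes this error, and the
  fleet grows only afterwards; in the surviving bound the fleet size enters through the initial law,
  \<open>d\<close> and \<open>v\<close> alone. A second obstacle is the quotient in
  \<open>f\<close>: its denominator has no positive lower bound on \<open>fluid_domain\<close>, so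
  Lipschitz estimates are made on the simplex only. The estimates for differential equations and
  processes are stated for a globally Lipschitz field, and the fleet and all solutions are shown to
  remain where this field agrees with \<open>f\<close>.\<close>

lemma integral_has_vector_derivative_atLeast:
  fixes f :: "real \<Rightarrow> 'a::banach"
  assumes "continuous_on {a..} f" and "a \<le> t"
  shows "((\<lambda>u. integral {a..u} f) has_vector_derivative f t) (at t within {a..})"
proof -
  have "((\<lambda>u. integral {a..u} f) has_vector_derivative f t) (at t within {a..t+1})"
    by (rule integral_has_vector_derivative) (use assms in \<open>auto intro: continuous_on_subset\<close>)
  moreover have "at t within {a..t+1} = at t within {a..}"
    by (rule at_within_nhd[where S="{..<t+1}"]) auto
  ultimately show ?thesis by simp
qed

lemma has_integral_exp_mult:
  fixes w :: real
  assumes "w > 0" and "0 \<le> t"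
  shows "((\<lambda>s. exp (w * s)) has_integral (exp (w * t) - 1) / w) {0..t}"
proof -
  have "((\<lambda>s. exp (w * s)) has_integral (exp (w * t) / w - exp (w * 0) / w)) {0..t}"
    by (rule fundamental_theorem_of_calculus)
      (use assms in \<open>auto intro!: derivative_eq_intros
        simp: has_real_derivative_iff_has_vector_derivative[symmetric]\<close>)
  then show ?thesis by (simp add: diff_divide_distrib)
qed

text \<open>Banach's fixed point theorem for \<open>u t = exp (- w * t) *\<^sub>R y t\<close>; the weight, with \<open>w > L\<close>,
  makes the Picard operator a contraction on the whole half-line at once.\<close>

lemma lipschitz_ode_solution_exists:
  fixes F :: "'a::euclidean_space \<Rightarrow> 'a"
  assumes lip: "L-lipschitz_on UNIV F"
  shows "\<exists>y. y 0 = y0 \<and> (\<forall>t\<ge>0. (y has_vector_derivative F (y t)) (at t within {0..}))"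
proof -
  \<comment> \<open>\<open>L + 1\<close> is positive even for \<open>L = 0\<close>, so division by
    \<open>w\<close> is allowed and the contraction factor \<open>L / w\<close> is below 1.\<close>
  define w where "w = L + 1"
  have L: "L \<ge> 0" using lip by (rule lipschitz_on_nonneg)
  have w: "w > 0" "L < w" using L by (auto simp: w_def)
  have Flip: "norm (F a - F b) \<le> L * norm (a - b)" for a b
    using lipschitz_onD[OF lip, of a b] by (simp add: dist_norm)
  have Fcont: "continuous_on UNIV F" by (rule lipschitz_on_continuous_on[OF lip])
  define G where "G u s = F (exp (w * s) *\<^sub>R apply_bcontfun u s)" for u s
  have ucont: "continuous_on A (apply_bcontfun u)" for A and u :: "real \<Rightarrow>\<^sub>C 'a"
    by (rule continuous_on_subset[OF continuous_on_apply_bcontfun]) auto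
  have Gcont: "continuous_on A (G u)" for A u
    unfolding G_def
    by (rule continuous_on_compose2[OF Fcont]) (auto intro!: continuous_intros ucont)
  have Gint: "G u integrable_on {0..t}" for u t
    by (rule integrable_continuous_real[OF Gcont])
  define I where "I u t = integral {0..t} (G u)" for u t
  have Ider: "(I u has_vector_derivative G u t) (at t within {0..})" if "0 \<le> t" for u t
    unfolding I_def by (rule integral_has_vector_derivative_atLeast[OF Gcont that])
  have Icont: "continuous_on {0..} (I u)" for u
    using Ider has_vector_derivative_continuous continuous_on_eq_continuous_within by (metis atLeast_iff)
  \<comment> \<open>Bounded continuous functions live on the whole real line; \<open>max 0 t\<close>
    freezes the operator at the value \<open>y0\<close> for negative times.\<close>
  define \<Phi> where "\<Phi> u t = exp (- (w * max 0 t)) *\<^sub>R (y0 + I u (max 0 t))" for u t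
  \<comment> \<open>Growth at rate \<open>w\<close> is reproduced by integration with a factor
    \<open>1 / w\<close>. This yields both the boundedness of \<open>\<Phi> u\<close> and the
    contraction factor.\<close>
  have int_bound: "norm (integral {0..t} f) \<le> c * exp (w * t) / w"
    if "f integrable_on {0..t}" and "\<And>s. s \<in> {0..t} \<Longrightarrow> norm (f s) \<le> c * exp (w * s)"
      and "0 \<le> c" and "0 \<le> t" for f :: "real \<Rightarrow> 'a" and c t
  proof -
    have hi: "((\<lambda>s. c * exp (w * s)) has_integral c * ((exp (w * t) - 1) / w)) {0..t}"
      by (rule has_integral_mult_right[OF has_integral_exp_mult[OF w(1) that(4)]])
    have "norm (integral {0..t} f) \<le> integral {0..t} (\<lambda>s. c * exp (w * s))"
      by (rule integral_norm_bound_integral) (use that hi in auto)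
    also have "\<dots> = c * ((exp (w * t) - 1) / w)" using hi by (rule integral_unique)
    also have "\<dots> \<le> c * (exp (w * t) / w)"
      using w that by (intro mult_left_mono divide_right_mono) auto
    finally show ?thesis by simp
  qed
  have \<Phi>bc: "\<Phi> u \<in> bcontfun" for u
  proof (rule bcontfun_normI)
    show "continuous_on UNIV (\<Phi> u)"
      unfolding \<Phi>_def
      by (intro continuous_intros continuous_on_compose2[OF Icont]) auto
    show "norm (\<Phi> u t) \<le> norm y0 + (norm (F 0) + L * norm u) / w" for t
    proof -
      define \<tau> where "\<tau> = max 0 t"
      have \<tau>: "0 \<le> \<tau>" by (simp add: \<tau>_def)
      let ?c = "norm (F 0) + L * norm u"
      have "norm (I u \<tau>) \<le> ?c * exp (w * \<tau>) / w"
        unfolding I_def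
      proof (rule int_bound[OF Gint])
        fix s assume s: "s \<in> {0..\<tau>}"
        have e1: "1 \<le> exp (w * s)" using s w by simp
        have "norm (G u s) \<le> norm (F 0) + norm (F (exp (w * s) *\<^sub>R apply_bcontfun u s) - F 0)"
          unfolding G_def by (rule norm_triangle_sub)
        also have "\<dots> \<le> norm (F 0) + L * norm (exp (w * s) *\<^sub>R apply_bcontfun u s)"
          using Flip[of _ 0] by (metis add_left_mono diff_zero)
        also have "\<dots> \<le> norm (F 0) * exp (w * s) + L * (exp (w * s) * norm u)"
          using e1 L norm_bounded[of u s]
          by (intro add_mono mult_left_mono) (auto simp: mult_le_cancel_left1)
        finally show "norm (G u s) \<le> ?c * exp (w * s)" by (simp add: algebra_simps)
      qed (use L \<tau> in auto)
      then have "norm (y0 + I u \<tau>) \<le> norm y0 + ?c * exp (w * \<tau>) / w"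
        using norm_triangle_ineq[of y0 "I u \<tau>"] by simp
      then have "exp (- (w * \<tau>)) * norm (y0 + I u \<tau>)
          \<le> exp (- (w * \<tau>)) * (norm y0 + ?c * exp (w * \<tau>) / w)"
        by (rule mult_left_mono) simp
      also have "\<dots> = exp (- (w * \<tau>)) * norm y0 + ?c / w"
        by (simp add: algebra_simps exp_minus)
      also have "\<dots> \<le> norm y0 + ?c / w"
        using \<tau> w by (simp add: mult_left_le_one_le)
      finally show ?thesis by (simp add: \<Phi>_def \<tau>_def)
    qed
  qed
  have contr: "dist (Bcontfun (\<Phi> u)) (Bcontfun (\<Phi> v)) \<le> L / w * dist u v" for u v
  proof (rule dist_bound)
    fix t :: real
    define \<tau> where "\<tau> = max 0 t"
    have \<tau>: "0 \<le> \<tau>" by (simp add: \<tau>_def)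
    have "norm (integral {0..\<tau>} (\<lambda>s. G u s - G v s)) \<le> (L * dist u v) * exp (w * \<tau>) / w"
    proof (rule int_bound)
      show "(\<lambda>s. G u s - G v s) integrable_on {0..\<tau>}" by (intro integrable_diff Gint)
      fix s
      have "norm (G u s - G v s) \<le> L * norm (exp (w * s) *\<^sub>R (apply_bcontfun u s - apply_bcontfun v s))"
        unfolding G_def using Flip by (metis scaleR_right_diff_distrib)
      also have "\<dots> \<le> L * (exp (w * s) * dist u v)"
        using L dist_bounded[of u s v] by (intro mult_left_mono) (auto simp: dist_norm)
      finally show "norm (G u s - G v s) \<le> (L * dist u v) * exp (w * s)" by (simp add: mult_ac)
    qed (use L \<tau> in auto)
    moreover have "integral {0..\<tau>} (\<lambda>s. G u s - G v s) = I u \<tau> - I v \<tau>"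
      unfolding I_def by (rule Henstock_Kurzweil_Integration.integral_diff[OF Gint Gint])
    ultimately have b: "norm (I u \<tau> - I v \<tau>) \<le> (L * dist u v) * exp (w * \<tau>) / w" by simp
    have "dist (\<Phi> u t) (\<Phi> v t) = exp (- (w * \<tau>)) * norm (I u \<tau> - I v \<tau>)"
      by (simp add: \<Phi>_def \<tau>_def dist_norm flip: scaleR_diff_right)
    also have "\<dots> \<le> exp (- (w * \<tau>)) * ((L * dist u v) * exp (w * \<tau>) / w)"
      using b by (rule mult_left_mono) simp
    also have "\<dots> = L / w * dist u v" by (simp add: exp_minus)
    finally show "dist (apply_bcontfun (Bcontfun (\<Phi> u)) t) (apply_bcontfun (Bcontfun (\<Phi> v)) t)
        \<le> L / w * dist u v"
      using \<Phi>bc by (simp add: Bcontfun_inverse)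
  qed
  have "\<exists>!u. Bcontfun (\<Phi> u) = u"
    by (rule banach_fix_type[of "L / w"]) (use L w contr in auto)
  then obtain u where u: "Bcontfun (\<Phi> u) = u" by auto
  then have fixpt: "apply_bcontfun u t = \<Phi> u t" for t
    using \<Phi>bc by (metis Bcontfun_inverse)
  \<comment> \<open>For \<open>t \<ge> 0\<close> this is the fixed point with its weight removed,
    \<open>exp (w * t) *\<^sub>R u t\<close>, written in integral form so that its derivative can be
    read off.\<close>
  define y where "y t = y0 + I u t" for t
  have G: "G u t = F (y t)" if "0 \<le> t" for t
    using that by (simp add: G_def fixpt \<Phi>_def y_def flip: exp_add)
  show ?thesis
  proof (intro exI[of _ y] conjI allI impI)
    show "y 0 = y0" by (simp add: y_def I_def)
    fix t :: real assume t: "0 \<le> t"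
    have "((\<lambda>t. y0 + I u t) has_vector_derivative 0 + G u t) (at t within {0..})"
      by (intro has_vector_derivative_add has_vector_derivative_const Ider t)
    then show "(y has_vector_derivative F (y t)) (at t within {0..})"
      using G[OF t] by (simp add: y_def[abs_def])
  qed
qed

text \<open>The comparison arguments below (uniqueness, positivity, conservation of mass) all reduce
  to this. Differentiating within \<open>{0..}\<close> admits 0 as an endpoint.\<close>

lemma has_real_derivative_nonpos_imp_le:
  fixes e :: "real \<Rightarrow> real"
  assumes der: "\<And>t. 0 \<le> t \<Longrightarrow> (e has_real_derivative e' t) (at t within {0..})"
    and "\<And>t. 0 \<le> t \<Longrightarrow> e' t \<le> 0" and "0 \<le> a" "a \<le> b"
  shows "e b \<le> e a"
proof -
  have "(e' has_integral (e b - e a)) {a..b}"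
    by (rule fundamental_theorem_of_calculus)
      (use assms in \<open>auto intro: has_vector_derivative_within_subset
        simp: has_real_derivative_iff_has_vector_derivative[symmetric]
          intro!: DERIV_subset[OF der]\<close>)
  then have "e b - e a \<le> 0"
    by (rule has_integral_le[OF _ has_integral_0]) (use assms in auto)
  then show ?thesis by simp
qed

text \<open>Gronwall's argument in differentiated form: the squared distance grows at rate at most
  \<open>2 * L\<close>, so its product with \<open>exp (- 2 * L * t)\<close> is nonincreasing, and
  it starts at 0.\<close>

lemma lipschitz_ode_solution_unique:
  fixes F :: "'a::real_inner \<Rightarrow> 'a"
  assumes lip: "L-lipschitz_on UNIV F"
    and y: "\<And>t. 0 \<le> t \<Longrightarrow> (y has_vector_derivative F (y t)) (at t within {0..})"
    and z: "\<And>t. 0 \<le> t \<Longrightarrow> (z has_vector_derivative F (z t)) (at t within {0..})"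
    and init: "z 0 = y 0" and t: "0 \<le> t"
  shows "z t = y t"
proof -
  define e where "e t = exp (- 2 * L * t) * ((z t - y t) \<bullet> (z t - y t))" for t
  define e' where "e' t = exp (- 2 * L * t) *
      (2 * ((F (z t) - F (y t)) \<bullet> (z t - y t)) - 2 * L * ((z t - y t) \<bullet> (z t - y t)))" for t
  have "e t \<le> e 0"
  proof (rule has_real_derivative_nonpos_imp_le[where e=e and e'=e'])
    fix s :: real assume s: "0 \<le> s"
    have d: "((\<lambda>t. z t - y t) has_vector_derivative F (z s) - F (y s)) (at s within {0..})"
      by (intro has_vector_derivative_diff y z s)
    have "((\<lambda>t. (z t - y t) \<bullet> (z t - y t)) has_vector_derivative
        ((z s - y s) \<bullet> (F (z s) - F (y s)) + (F (z s) - F (y s)) \<bullet> (z s - y s))) (at s within {0..})"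
      using bounded_bilinear.has_vector_derivative[OF bounded_bilinear_inner d d] .
    then have i: "((\<lambda>t. (z t - y t) \<bullet> (z t - y t)) has_real_derivative
        2 * ((F (z s) - F (y s)) \<bullet> (z s - y s))) (at s within {0..})"
      by (simp add: has_real_derivative_iff_has_vector_derivative inner_commute)
    have x: "((\<lambda>t. exp (- 2 * L * t)) has_real_derivative - 2 * L * exp (- 2 * L * s)) (at s within {0..})"
      by (auto intro!: derivative_eq_intros)
    show "(e has_real_derivative e' s) (at s within {0..})"
      unfolding e_def[abs_def] e'_def
      using DERIV_mult'[OF x i] by (rule DERIV_cong) (simp add: algebra_simps)
    have "(F (z s) - F (y s)) \<bullet> (z s - y s) \<le> norm (F (z s) - F (y s)) * norm (z s - y s)"
      by (rule norm_cauchy_schwarz)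
    also have "\<dots> \<le> (L * norm (z s - y s)) * norm (z s - y s)"
      using lipschitz_onD[OF lip, of "z s" "y s"] by (intro mult_right_mono) (auto simp: dist_norm)
    also have "\<dots> = L * ((z s - y s) \<bullet> (z s - y s))"
      by (simp add: power2_norm_eq_inner[symmetric] power2_eq_square)
    finally show "e' s \<le> 0" by (simp add: e'_def mult_le_0_iff)
  qed (use t in auto)
  then have "exp (- 2 * L * t) * (norm (z t - y t))\<^sup>2 \<le> 0"
    by (simp add: e_def init power2_norm_eq_inner)
  then have "(norm (z t - y t))\<^sup>2 \<le> 0" by (simp add: mult_le_0_iff)
  then show ?thesis by simp
qed

section \<open>Jump processes close to the solution of a differential equation\<close>

text \<open>\<open>E (Suc n)\<close> removes from \<open>E n\<close> the paths on which \<open>W n\<close> has reached \<open>a\<close>.  No filtration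
  is needed, as the supermartingale property enters only integrated over these events.\<close>

lemma (in finite_measure) supermartingale_maximal_inequality:
  fixes W :: "nat \<Rightarrow> 'a \<Rightarrow> real" and E :: "nat \<Rightarrow> 'a set"
  assumes int: "\<And>n. n \<le> m \<Longrightarrow> integrable M (W n)"
    and nonneg: "\<And>n \<omega>. n \<le> m \<Longrightarrow> \<omega> \<in> space M \<Longrightarrow> 0 \<le> W n \<omega>"
    and E: "\<And>n. n \<le> Suc m \<Longrightarrow> E n \<in> sets M"
    and E_Suc: "\<And>n. n \<le> m \<Longrightarrow> E (Suc n) = {\<omega> \<in> E n. W n \<omega> < a}"
    and super: "\<And>n. n < m \<Longrightarrow>
      (LINT \<omega>|M. indicator (E (Suc n)) \<omega> * W (Suc n) \<omega>)
        \<le> (LINT \<omega>|M. indicator (E (Suc n)) \<omega> * W n \<omega>)"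
  shows "a * measure M (E 0 - E (Suc m)) \<le> (LINT \<omega>|M. indicator (E 0) \<omega> * W 0 \<omega>)"
proof -
  let ?I = "\<lambda>A n. LINT \<omega>|M. indicator A \<omega> * W n \<omega>"
  have intE: "integrable M (\<lambda>\<omega>. indicator A \<omega> * W n \<omega>)" if "A \<in> sets M" "n \<le> m" for A n
    using integrable_mult_indicator[OF that(1) int[OF that(2)]] by simp
  \<comment> \<open>Split \<open>E n\<close> according to \<open>W n\<close>: on the removed part
    \<open>W n\<close> is at least \<open>a\<close>, and the rest is
    \<open>E (Suc n)\<close>.\<close>
  have step: "a * measure M (E n - E (Suc n)) + ?I (E (Suc n)) n \<le> ?I (E n) n" if n: "n \<le> m" for n
  proof -
    have s: "E n \<in> sets M" "E (Suc n) \<in> sets M" using E n by auto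
    have sub: "E (Suc n) \<subseteq> E n" using E_Suc[OF n] by auto
    have "a * measure M (E n - E (Suc n)) = (LINT \<omega>|M. a * indicator (E n - E (Suc n)) \<omega>)"
      using s by simp
    also have "\<dots> + ?I (E (Suc n)) n
        = (LINT \<omega>|M. a * indicator (E n - E (Suc n)) \<omega> + indicator (E (Suc n)) \<omega> * W n \<omega>)"
      using s intE[OF s(2) n] by (subst Bochner_Integration.integral_add) (auto intro!: integrable_mult_right simp: less_top[symmetric])
    also have "\<dots> \<le> ?I (E n) n"
    proof (rule integral_mono)
      show "integrable M (\<lambda>\<omega>. a * indicator (E n - E (Suc n)) \<omega> + indicator (E (Suc n)) \<omega> * W n \<omega>)"
        using s intE[OF s(2) n] by (intro Bochner_Integration.integrable_add) (auto intro!: integrable_mult_right simp: less_top[symmetric])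
      show "integrable M (\<lambda>\<omega>. indicator (E n) \<omega> * W n \<omega>)" by (rule intE[OF s(1) n])
      show "a * indicator (E n - E (Suc n)) \<omega> + indicator (E (Suc n)) \<omega> * W n \<omega>
          \<le> indicator (E n) \<omega> * W n \<omega>" for \<omega>
        using sub by (auto simp: indicator_def E_Suc[OF n])
    qed
    finally show ?thesis .
  qed
  have ind: "a * measure M (E 0 - E n) + ?I (E n) n \<le> ?I (E 0) 0" if "n \<le> m" for n
    using that
  proof (induction n)
    case 0
    then show ?case by simp
  next
    case (Suc n)
    have dec: "E k \<subseteq> E 0" if "k \<le> Suc m" for k
      using that by (induction k) (auto simp: E_Suc)
    have "E 0 - E (Suc n) = (E 0 - E n) \<union> (E n - E (Suc n))"
      using dec[of n] E_Suc[of n] Suc.prems by auto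
    then have "measure M (E 0 - E (Suc n)) = measure M (E 0 - E n) + measure M (E n - E (Suc n))"
      using E Suc.prems by (subst finite_measure_Union[symmetric]) auto
    then show ?case
      using Suc.IH step[of n] super[of n] Suc.prems by (simp add: distrib_left)
  qed
  have dec: "E k \<subseteq> E 0" if "k \<le> Suc m" for k
    using that by (induction k) (auto simp: E_Suc)
  \<comment> \<open>The removal at the last time \<open>m\<close> is covered by \<open>step\<close>
    without a further supermartingale step; the integral left over on \<open>E (Suc m)\<close> is
    nonnegative and is dropped.\<close>
  have "E 0 - E (Suc m) = (E 0 - E m) \<union> (E m - E (Suc m))"
    using dec[of m] E_Suc[of m] by auto
  then have "measure M (E 0 - E (Suc m)) = measure M (E 0 - E m) + measure M (E m - E (Suc m))"
    using E by (subst finite_measure_Union[symmetric]) auto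
  moreover have "0 \<le> ?I (E (Suc m)) m"
    by (rule Bochner_Integration.integral_nonneg_AE) (use nonneg[of m] in \<open>auto intro!: AE_I2\<close>)
  ultimately show ?thesis
    using ind[of m] step[of m] by (simp add: distrib_left)
qed

section \<open>The Markov property, integrated over events of the past\<close>

lemma past_space_sets:
  assumes "\<And>t. 0 \<le> t \<Longrightarrow> X t \<in> measurable M (count_space S)"
  shows "space (past M S X s) = space M" "sets (past M S X s) \<subseteq> sets M"
proof -
  have P: "{X u -` A \<inter> space M | u A. 0 \<le> u \<and> u \<le> s \<and> A \<subseteq> S} \<subseteq> Pow (space M)" by auto
  show "space (past M S X s) = space M"
    unfolding past_def by (rule space_measure_of[OF P])
  show "sets (past M S X s) \<subseteq> sets M"
    unfolding past_def sets_measure_of[OF P]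
  proof (rule sets.sigma_sets_subset, safe)
    fix u :: real and A assume "0 \<le> u" "A \<subseteq> S"
    then show "X u -` A \<inter> space M \<in> sets M"
      using measurable_sets[OF assms[of u], of A] by simp
  qed
qed

text \<open>The past contains the preimages of all subsets of the discrete state set, so
  \<open>Q\<close> may be any predicate.\<close>

lemma vimage_in_past:
  assumes "0 \<le> u" "u \<le> s" "\<And>t. 0 \<le> t \<Longrightarrow> X t \<in> measurable M (count_space S)"
  shows "{\<omega> \<in> space M. Q (X u \<omega>)} \<in> sets (past M S X s)"
proof -
  have P: "{X u -` A \<inter> space M | u A. 0 \<le> u \<and> u \<le> s \<and> A \<subseteq> S} \<subseteq> Pow (space M)" by auto
  have "{\<omega> \<in> space M. Q (X u \<omega>)} = X u -` {x \<in> S. Q x} \<inter> space M"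
    using measurable_space[OF assms(3)[OF assms(1)]] by auto
  then show ?thesis
    unfolding past_def sets_measure_of[OF P] using assms(1,2)
    by (intro sigma_sets.Basic CollectI exI[of _ u] exI[of _ "{x \<in> S. Q x}"]) auto
qed

lemma integrable_function_of_state:
  fixes \<phi> :: "'a \<Rightarrow> real"
  assumes "prob_space M" "finite S" "X \<in> measurable M (count_space S)"
  shows "integrable M (\<lambda>\<omega>. \<phi> (X \<omega>))"
proof -
  interpret prob_space M by fact
  have "X \<omega> \<in> S" if "\<omega> \<in> space M" for \<omega> using measurable_space[OF assms(3) that] by simp
  then have b: "norm (\<phi> (X \<omega>)) \<le> (\<Sum>x\<in>S. \<bar>\<phi> x\<bar>)" if "\<omega> \<in> space M" for \<omega>
    using member_le_sum[of "X \<omega>" S "\<lambda>x. \<bar>\<phi> x\<bar>"] assms(2) that by auto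
  have "(\<lambda>\<omega>. \<phi> (X \<omega>)) \<in> borel_measurable M"
    by (rule measurable_compose[OF assms(3)]) simp
  then show ?thesis
    by (rule integrable_const_bound[rotated]) (use b in auto)
qed

text \<open>The hypothesis speaks of indicators of single states; as \<open>S\<close> is finite,
  \<open>\<phi> (X (s + h))\<close> is a linear combination of these. Integrating over an event
  \<open>B\<close> of the past eliminates conditional expectations from the rest of the
  argument.\<close>

lemma markov_property_integral:
  fixes \<phi> :: "'a \<Rightarrow> real"
  assumes M: "prob_space M" and S: "finite S"
    and X: "\<And>t. 0 \<le> t \<Longrightarrow> X t \<in> measurable M (count_space S)"
    and cond: "\<And>y. y \<in> S \<Longrightarrow> AE \<omega> in M.
           real_cond_exp M (past M S X s) (indicator (X (s + h) -` {y} \<inter> space M)) \<omega>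
             = pmf (P (X s \<omega>)) y"
    and s: "0 \<le> s" "0 \<le> h" and B: "B \<in> sets (past M S X s)"
  shows "(LINT \<omega>|M. indicator B \<omega> * \<phi> (X (s + h) \<omega>))
    = (LINT \<omega>|M. indicator B \<omega> * (\<Sum>y\<in>S. pmf (P (X s \<omega>)) y * \<phi> y))"
proof -
  interpret prob_space M by fact
  have fs: "finite_measure_subalgebra M (past M S X s)"
    using past_space_sets[OF X, where s=s]
    by unfold_locales (simp add: subalgebra_def)
  interpret finite_measure_subalgebra M "past M S X s" by fact
  have BM: "B \<in> sets M" by (rule subsetD[OF past_space_sets(2)[OF X] B])
  let ?A = "\<lambda>y. X (s + h) -` {y} \<inter> space M"
  have A: "?A y \<in> sets M" if "y \<in> S" for y
    using measurable_sets[OF X[of "s + h"], of "{y}"] s that by simp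
  have one: "(LINT \<omega>|M. indicator B \<omega> * indicator (?A y) \<omega>)
      = (LINT \<omega>|M. indicator B \<omega> * pmf (P (X s \<omega>)) y)" if y: "y \<in> S" for y
  proof -
    have "(LINT \<omega>|M. indicator B \<omega> * indicator (?A y) \<omega>)
        = (LINT \<omega>|M. indicator B \<omega> * real_cond_exp M (past M S X s) (indicator (?A y)) \<omega>)"
      by (rule real_cond_exp_intg(2)[symmetric])
        (use A[OF y] BM B in \<open>auto intro!: borel_measurable_integrable simp: less_top[symmetric] indicator_inter_arith[symmetric]\<close>)
    also have "\<dots> = (LINT \<omega>|M. indicator B \<omega> * pmf (P (X s \<omega>)) y)"
    proof (rule integral_cong_AE)
      show "(\<lambda>\<omega>. indicator B \<omega> * pmf (P (X s \<omega>)) y) \<in> borel_measurable M"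
        using BM measurable_compose[OF X[OF s(1)], of "\<lambda>x. pmf (P x) y" borel] by simp
      show "AE \<omega> in M. indicator B \<omega> * real_cond_exp M (past M S X s) (indicator (?A y)) \<omega> =
          indicator B \<omega> * pmf (P (X s \<omega>)) y"
        using cond[OF y] by eventually_elim simp
    qed (use BM in auto)
    finally show ?thesis .
  qed
  have "(LINT \<omega>|M. indicator B \<omega> * \<phi> (X (s + h) \<omega>))
      = (LINT \<omega>|M. (\<Sum>y\<in>S. \<phi> y * (indicator B \<omega> * indicator (?A y) \<omega>)))"
  proof (rule Bochner_Integration.integral_cong[OF refl])
    fix \<omega> assume w: "\<omega> \<in> space M"
    have XS: "X (s + h) \<omega> \<in> S" using measurable_space[OF X[of "s+h"] w] s by simp
    have "(\<Sum>y\<in>S. \<phi> y * (indicator B \<omega> * indicator (?A y) \<omega>))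
        = (\<Sum>y\<in>S. if y = X (s + h) \<omega> then indicator B \<omega> * \<phi> y else 0)"
      using w by (intro sum.cong) (auto simp: indicator_def)
    also have "\<dots> = indicator B \<omega> * \<phi> (X (s + h) \<omega>)"
      using S XS by simp
    finally show "indicator B \<omega> * \<phi> (X (s + h) \<omega>)
      = (\<Sum>y\<in>S. \<phi> y * (indicator B \<omega> * indicator (?A y) \<omega>))" by simp
  qed
  also have "\<dots> = (\<Sum>y\<in>S. \<phi> y * (LINT \<omega>|M. indicator B \<omega> * indicator (?A y) \<omega>))"
    using A BM by (subst Bochner_Integration.integral_sum)
      (auto intro!: integrable_mult_right simp: less_top[symmetric] indicator_inter_arith[symmetric])
  also have "\<dots> = (\<Sum>y\<in>S. \<phi> y * (LINT \<omega>|M. indicator B \<omega> * pmf (P (X s \<omega>)) y))"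
    by (intro sum.cong refl arg_cong2[where f="(*)"] one)
  also have "\<dots> = (LINT \<omega>|M. (\<Sum>y\<in>S. \<phi> y * (indicator B \<omega> * pmf (P (X s \<omega>)) y)))"
  proof -
    have "integrable M (\<lambda>\<omega>. indicator B \<omega> * pmf (P (X s \<omega>)) y)" for y
      using integrable_mult_indicator[OF BM integrable_function_of_state[OF M S X[OF s(1)],
        of "\<lambda>x. pmf (P x) y"]] by simp
    then show ?thesis
      by (subst Bochner_Integration.integral_sum) (auto intro!: integrable_mult_right)
  qed
  finally show ?thesis
    by (simp add: sum_distrib_left mult_ac)
qed

section \<open>One-step estimate of the mean squared deviation\<close>

lemma sum_sq_dist_expand:
  fixes x y y' :: "'a::real_inner" and p :: "'a::real_inner \<Rightarrow> real"
  assumes "sum p S = 1"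
  defines "m \<equiv> \<Sum>z\<in>S. p z *\<^sub>R (z - x)"
  shows "(\<Sum>z\<in>S. p z * (norm (z - y'))\<^sup>2) = (norm (x - y))\<^sup>2 + 2 * ((x - y) \<bullet> (m - (y' - y)))
    + (\<Sum>z\<in>S. p z * (norm (z - x))\<^sup>2) - 2 * (m \<bullet> (y' - y)) + (norm (y' - y))\<^sup>2"
proof -
  \<comment> \<open>Expand \<open>|u + a - w|\<^sup>2\<close> with \<open>u = x - y\<close> and
    \<open>a = z - x\<close>, then average over \<open>z\<close>. When \<open>p\<close> is a
    transition law over time \<open>h\<close> and \<open>w\<close> an increment of the solution, the
    last two terms are of second order in \<open>h\<close>; what matters is the mismatch
    \<open>m - w\<close> and the variance.\<close>
  define w where "w = y' - y"
  have "p z * (norm (z - y'))\<^sup>2 = p z * ((norm (x - y))\<^sup>2 - 2 * ((x - y) \<bullet> w) + (norm w)\<^sup>2)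
      + 2 * ((x - y) \<bullet> (p z *\<^sub>R (z - x))) + p z * (norm (z - x))\<^sup>2 - 2 * ((p z *\<^sub>R (z - x)) \<bullet> w)" for z
  proof -
    have "y' = w + y" by (simp add: w_def)
    then show ?thesis
      by (simp add: power2_norm_eq_inner inner_simps inner_commute algebra_simps)
  qed
  then have "(\<Sum>z\<in>S. p z * (norm (z - y'))\<^sup>2)
      = (\<Sum>z\<in>S. p z) * ((norm (x - y))\<^sup>2 - 2 * ((x - y) \<bullet> w) + (norm w)\<^sup>2)
        + 2 * ((x - y) \<bullet> m) + (\<Sum>z\<in>S. p z * (norm (z - x))\<^sup>2) - 2 * (m \<bullet> w)"
    by (simp only: m_def sum.distrib sum_subtractf sum_distrib_left sum_distrib_right
        inner_sum_left inner_sum_right)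
  then show ?thesis
    using assms(1) by (simp add: w_def inner_diff_right algebra_simps)
qed

text \<open>Integrating the bound \<open>B\<close> gives the first estimate. By it, \<open>F\<close>
  varies along \<open>y\<close> by at most \<open>L * B * h\<close> on \<open>[t, t + h]\<close>,
  and a second integration gives the remainder. The constants are free of \<open>t\<close>, which
  makes the one-step estimate uniform in time.\<close>

lemma lipschitz_ode_increment:
  fixes F :: "'a::euclidean_space \<Rightarrow> 'a"
  assumes lip: "L-lipschitz_on UNIV F"
    and y: "\<And>t. 0 \<le> t \<Longrightarrow> (y has_vector_derivative F (y t)) (at t within {0..})"
    and B: "\<And>t. 0 \<le> t \<Longrightarrow> norm (F (y t)) \<le> B"
    and th: "0 \<le> t" "0 \<le> h"
  shows "norm (y (t + h) - y t) \<le> B * h"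
    and "norm (y (t + h) - y t - h *\<^sub>R F (y t)) \<le> L * B * h\<^sup>2"
proof -
  have B0: "0 \<le> B" using B[of 0] norm_ge_zero order_trans by blast
  have L: "L \<ge> 0" using lip by (rule lipschitz_on_nonneg)
  have int: "((\<lambda>s. F (y s)) has_integral (y (t + s) - y t)) {t..t + s}" if "0 \<le> s" for s
    by (rule fundamental_theorem_of_calculus)
      (use that th in \<open>auto intro: has_vector_derivative_within_subset[OF y]\<close>)
  have 1: "norm (y (t + s) - y t) \<le> B * s" if s: "0 \<le> s" for s
  proof -
    have "norm (y (t + s) - y t) \<le> B * measure lborel {t..t + s}"
      by (rule has_integral_bound_real[OF B0 finite.emptyI int[OF s]]) (use B th in auto)
    then show ?thesis using s by simp
  qed
  show "norm (y (t + h) - y t) \<le> B * h" by (rule 1) fact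
  have int': "((\<lambda>s. F (y s) - F (y t)) has_integral
      (y (t + h) - y t) - measure lborel {t..t + h} *\<^sub>R F (y t)) {t..t + h}"
    by (intro has_integral_diff int has_integral_const_real th)
  have "norm ((y (t + h) - y t) - measure lborel {t..t + h} *\<^sub>R F (y t))
      \<le> (L * (B * h)) * measure lborel {t..t + h}"
  proof (rule has_integral_bound_real[OF _ finite.emptyI int'])
    show "0 \<le> L * (B * h)" using L B0 th by simp
    fix s assume s: "s \<in> {t..t + h} - {}"
    have "norm (F (y s) - F (y t)) \<le> L * norm (y s - y t)"
      using lipschitz_onD[OF lip, of "y s" "y t"] by (simp add: dist_norm)
    also have "norm (y s - y t) \<le> B * (s - t)" using 1[of "s - t"] s by simp
    also have "B * (s - t) \<le> B * h" using s B0 by (intro mult_left_mono) auto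
    finally show "norm (F (y s) - F (y t)) \<le> L * (B * h)" using L by (simp add: mult_left_mono)
  qed
  then show "norm (y (t + h) - y t - h *\<^sub>R F (y t)) \<le> L * B * h\<^sup>2"
    using th by (simp add: power2_eq_square mult_ac)
qed

text \<open>Since \<open>\<phi> x x = 0\<close>, the probability of staying at \<open>x\<close>
  drops out and the off-diagonal rates determine the limit. Finiteness of \<open>S\<close> makes the
  error uniform in \<open>x\<close>. The cases of interest are \<open>z - x\<close> and
  \<open>(norm (z - x))\<^sup>2\<close>.\<close>

lemma transition_semigroup_moment:
  fixes \<phi> :: "'a \<Rightarrow> 'a \<Rightarrow> 'b::real_normed_vector"
  assumes P: "transition_semigroup_with_rates S q P"
    and \<phi>: "\<And>x. x \<in> S \<Longrightarrow> \<phi> x x = 0" and "\<eta> > 0"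
  shows "\<forall>\<^sub>F h in at_right 0. \<forall>x\<in>S.
    norm ((\<Sum>z\<in>S. pmf (P h x) z *\<^sub>R \<phi> x z) - h *\<^sub>R (\<Sum>z\<in>S - {x}. q x z *\<^sub>R \<phi> x z)) \<le> \<eta> * h"
proof (rule eventually_ball_finite)
  show fin: "finite S" using P by (simp add: transition_semigroup_with_rates_def)
  show "\<forall>x\<in>S. \<forall>\<^sub>F h in at_right 0.
    norm ((\<Sum>z\<in>S. pmf (P h x) z *\<^sub>R \<phi> x z) - h *\<^sub>R (\<Sum>z\<in>S - {x}. q x z *\<^sub>R \<phi> x z)) \<le> \<eta> * h"
  proof
    fix x assume x: "x \<in> S"
    have "((\<lambda>h. \<Sum>z\<in>S - {x}. (pmf (P h x) z / h) *\<^sub>R \<phi> x z) \<longlongrightarrow> (\<Sum>z\<in>S - {x}. q x z *\<^sub>R \<phi> x z)) (at_right 0)"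
      using P x by (intro tendsto_sum tendsto_scaleR tendsto_const)
        (auto simp: transition_semigroup_with_rates_def)
    from tendstoD[OF this \<open>\<eta> > 0\<close>] eventually_at_right_less[of 0]
    show "\<forall>\<^sub>F h in at_right 0.
      norm ((\<Sum>z\<in>S. pmf (P h x) z *\<^sub>R \<phi> x z) - h *\<^sub>R (\<Sum>z\<in>S - {x}. q x z *\<^sub>R \<phi> x z)) \<le> \<eta> * h"
    proof eventually_elim
      case (elim h)
      let ?d = "(\<Sum>z\<in>S - {x}. (pmf (P h x) z / h) *\<^sub>R \<phi> x z) - (\<Sum>z\<in>S - {x}. q x z *\<^sub>R \<phi> x z)"
      have "(\<Sum>z\<in>S. pmf (P h x) z *\<^sub>R \<phi> x z) = (\<Sum>z\<in>S - {x}. pmf (P h x) z *\<^sub>R \<phi> x z)"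
        using \<phi>[OF x] x fin by (simp add: sum.remove)
      also have "\<dots> = h *\<^sub>R (\<Sum>z\<in>S - {x}. (pmf (P h x) z / h) *\<^sub>R \<phi> x z)"
        using elim(2) by (simp add: scaleR_sum_right)
      finally have "(\<Sum>z\<in>S. pmf (P h x) z *\<^sub>R \<phi> x z) - h *\<^sub>R (\<Sum>z\<in>S - {x}. q x z *\<^sub>R \<phi> x z) = h *\<^sub>R ?d"
        by (simp add: scaleR_diff_right)
      then have "norm ((\<Sum>z\<in>S. pmf (P h x) z *\<^sub>R \<phi> x z) - h *\<^sub>R (\<Sum>z\<in>S - {x}. q x z *\<^sub>R \<phi> x z))
          = norm ?d * h" using elim(2) by simp
      also have "\<dots> \<le> \<eta> * h" using elim by (intro mult_right_mono) (auto simp: dist_norm)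
      finally show ?case .
    qed
  qed
qed

text \<open>With \<open>u = x - y t\<close>, mean increment \<open>m\<close> of the process, its
  drift \<open>b x\<close> and the increment \<open>w\<close> of \<open>y\<close>, the mismatch
  \<open>m - w\<close> is telescoped through \<open>h * b x\<close>, \<open>h * F x\<close> and
  \<open>h * F (y t)\<close>. Paired with \<open>u\<close>, the pieces cost in turn a semigroup
  error, the defect \<open>d\<close>, the Lipschitz term \<open>L * |u|\<^sup>2\<close> and the
  curvature of \<open>y\<close>.\<close>

lemma mean_sq_deviation_step:
  fixes F :: "'a::euclidean_space \<Rightarrow> 'a"
  assumes P: "transition_semigroup_with_rates S q P"
    and lip: "L-lipschitz_on UNIV F"
    and y: "\<And>t. 0 \<le> t \<Longrightarrow> (y has_vector_derivative F (y t)) (at t within {0..})"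
    and B: "\<And>t. 0 \<le> t \<Longrightarrow> norm (F (y t)) \<le> B"
    and R: "\<And>x t. x \<in> S \<Longrightarrow> 0 \<le> t \<Longrightarrow> norm (x - y t) \<le> R"
    and drift: "\<And>x. x \<in> S \<Longrightarrow> norm ((\<Sum>z\<in>S - {x}. q x z *\<^sub>R (z - x)) - F x) \<le> d"
    and var: "\<And>x. x \<in> S \<Longrightarrow> (\<Sum>z\<in>S - {x}. q x z * (norm (z - x))\<^sup>2) \<le> v"
    and "\<delta> > 0"
  shows "\<forall>\<^sub>F h in at_right 0. \<forall>x\<in>S. \<forall>t\<ge>0.
    (\<Sum>z\<in>S. pmf (P h x) z * (norm (z - y (t + h)))\<^sup>2)
      \<le> (1 + 2 * L * h) * (norm (x - y t))\<^sup>2 + h * (2 * R * d + v + \<delta>)"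
proof (cases "S = {}")
  case False
  then have R0: "R \<ge> 0" using R[of _ 0] norm_ge_zero order_trans by blast
  have L: "L \<ge> 0" using lip by (rule lipschitz_on_nonneg)
  have B0: "0 \<le> B" using B[of 0] norm_ge_zero order_trans by blast
  have fin: "finite S" using P by (simp add: transition_semigroup_with_rates_def)
  define b where "b x = (\<Sum>z\<in>S - {x}. q x z *\<^sub>R (z - x))" for x
  define A where "A = (\<Sum>x\<in>S. norm (b x))"
  have A: "norm (b x) \<le> A" if "x \<in> S" for x
    unfolding A_def using fin that by (intro member_le_sum) auto
  have A0: "A \<ge> 0" by (simp add: A_def sum_nonneg)
  \<comment> \<open>The semigroup error enters as \<open>2 * R * \<eta>\<close> through the first
    moment and as \<open>\<eta>\<close> through the second. Together they use half of
    \<open>\<delta>\<close>; the other half is for the terms of order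
    \<open>h\<^sup>2\<close>.\<close>
  define \<eta> where "\<eta> = \<delta> / 2 / (2 * R + 1)"
  have \<eta>: "\<eta> > 0" "(2 * R + 1) * \<eta> = \<delta> / 2"
    using R0 \<open>\<delta> > 0\<close> by (auto simp: \<eta>_def add_nonneg_eq_0_iff field_simps)
  \<comment> \<open>The coefficients of \<open>h\<^sup>2\<close>, coming from the curvature of
    \<open>y\<close>, from \<open>m \<bullet> w\<close> and from
    \<open>(norm w)\<^sup>2\<close>.\<close>
  define C where "C = 2 * R * L * B + 2 * (A + \<eta>) * B + B\<^sup>2"
  have "((\<lambda>h. h * C) \<longlongrightarrow> 0 * C) (at_right 0)"
    by (intro tendsto_intros)
  then have "\<forall>\<^sub>F h in at_right 0. h * C < \<delta> / 2"
    using \<open>\<delta> > 0\<close> by (intro order_tendstoD) auto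
  moreover have "\<forall>\<^sub>F h in at_right 0. \<forall>x\<in>S.
      norm ((\<Sum>z\<in>S. pmf (P h x) z *\<^sub>R (z - x)) - h *\<^sub>R b x) \<le> \<eta> * h"
    unfolding b_def by (rule transition_semigroup_moment[OF P _ \<eta>(1)]) simp
  moreover have "\<forall>\<^sub>F h in at_right 0. \<forall>x\<in>S.
      norm ((\<Sum>z\<in>S. pmf (P h x) z *\<^sub>R (norm (z - x))\<^sup>2)
        - h *\<^sub>R (\<Sum>z\<in>S - {x}. q x z *\<^sub>R (norm (z - x))\<^sup>2)) \<le> \<eta> * h"
    by (rule transition_semigroup_moment[OF P _ \<eta>(1)]) simp
  ultimately show ?thesis
    using eventually_at_right_less[of 0]
  proof eventually_elim
    case (elim h)
    note h = elim(4)
    show ?case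
    proof (intro ballI allI impI)
      fix x and t :: real assume x: "x \<in> S" and t: "0 \<le> t"
      define m where "m = (\<Sum>z\<in>S. pmf (P h x) z *\<^sub>R (z - x))"
      define w where "w = y (t + h) - y t"
      define u where "u = x - y t"
      have sum1: "sum (pmf (P h x)) S = 1"
        using P x h fin by (intro sum_pmf_eq_1) (auto simp: transition_semigroup_with_rates_def)
      have mb: "norm (m - h *\<^sub>R b x) \<le> \<eta> * h" using elim(2) x by (simp add: m_def)
      have w: "norm w \<le> B * h" "norm (w - h *\<^sub>R F (y t)) \<le> L * B * h\<^sup>2"
        using lipschitz_ode_increment[OF lip y B t] h by (auto simp: w_def)
      have u: "norm u \<le> R" using R x t by (simp add: u_def)
      have "norm m \<le> norm (m - h *\<^sub>R b x) + norm (h *\<^sub>R b x)"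
        using norm_triangle_sub[of m "h *\<^sub>R b x"] by (simp add: add.commute)
      also have "\<dots> \<le> (A + \<eta>) * h" using mb mult_left_mono[OF A[OF x] less_imp_le[OF h]] h
        by (simp only: norm_scaleR distrib_right mult.commute[of A])
      finally have m: "norm m \<le> (A + \<eta>) * h" .
      have "u \<bullet> (m - h *\<^sub>R b x) \<le> R * (\<eta> * h)"
        using norm_cauchy_schwarz[of u] mult_mono[OF u mb R0 norm_ge_zero] by (rule order_trans)
      moreover have "u \<bullet> (b x - F x) \<le> R * d"
        using norm_cauchy_schwarz[of u] mult_mono[OF u drift[OF x] R0 norm_ge_zero]
        unfolding b_def by (rule order_trans)
      then have "h * (u \<bullet> (b x - F x)) \<le> h * (R * d)" using h by (intro mult_left_mono) auto
      moreover have "u \<bullet> (F x - F (y t)) \<le> norm u * (L * norm u)"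
        using norm_cauchy_schwarz[of u] 
          mult_left_mono[OF lipschitz_onD[OF lip, of x "y t", unfolded dist_norm] norm_ge_zero[of u]]
        unfolding u_def by (auto intro: order_trans)
      then have "h * (u \<bullet> (F x - F (y t))) \<le> h * (norm u * (L * norm u))" using h by (intro mult_left_mono) auto
      moreover have "(- u) \<bullet> (w - h *\<^sub>R F (y t)) \<le> R * (L * B * h\<^sup>2)"
        using norm_cauchy_schwarz[of "- u" "w - h *\<^sub>R F (y t)"] mult_mono[OF u w(2) R0 norm_ge_zero] by simp
      moreover have "u \<bullet> (m - w) = u \<bullet> (m - h *\<^sub>R b x) + h * (u \<bullet> (b x - F x))
          + h * (u \<bullet> (F x - F (y t))) + (- u) \<bullet> (w - h *\<^sub>R F (y t))"
        by (simp add: inner_simps algebra_simps)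
      ultimately have 1: "u \<bullet> (m - w) \<le> R * (\<eta> * h) + h * (R * d) + h * (norm u * (L * norm u)) + R * (L * B * h\<^sup>2)"
        by linarith
      have "(- m) \<bullet> w \<le> ((A + \<eta>) * h) * (B * h)"
        using norm_cauchy_schwarz[of "- m" w] mult_mono[OF m w(1) _ norm_ge_zero] A0 \<eta> h by simp
      then have 2: "- 2 * (m \<bullet> w) \<le> 2 * (A + \<eta>) * B * h\<^sup>2" by (simp add: power2_eq_square algebra_simps)
      have 3: "(norm w)\<^sup>2 \<le> B\<^sup>2 * h\<^sup>2"
        using power_mono[OF w(1) norm_ge_zero, of 2] by (simp add: power_mult_distrib)
      have "(\<Sum>z\<in>S. pmf (P h x) z * (norm (z - x))\<^sup>2) \<le> h * (\<Sum>z\<in>S - {x}. q x z * (norm (z - x))\<^sup>2) + \<eta> * h"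
        using elim(3)[rule_format, OF x] by (simp add: abs_le_iff)
      also have "\<dots> \<le> h * v + \<eta> * h" using var[OF x] h by (simp add: mult_left_mono)
      finally have 4: "(\<Sum>z\<in>S. pmf (P h x) z * (norm (z - x))\<^sup>2) \<le> h * v + \<eta> * h" .
      have "(\<Sum>z\<in>S. pmf (P h x) z * (norm (z - y (t + h)))\<^sup>2)
        = (norm u)\<^sup>2 + 2 * (u \<bullet> (m - w)) + (\<Sum>z\<in>S. pmf (P h x) z * (norm (z - x))\<^sup>2)
          - 2 * (m \<bullet> w) + (norm w)\<^sup>2"
        using sum_sq_dist_expand[OF sum1, of "y (t + h)" x "y t"] by (simp add: u_def m_def w_def)
      also have "\<dots> \<le> (norm u)\<^sup>2 + 2 * (R * (\<eta> * h) + h * (R * d) + h * (norm u * (L * norm u)) + R * (L * B * h\<^sup>2))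
          + (h * v + \<eta> * h) + 2 * (A + \<eta>) * B * h\<^sup>2 + B\<^sup>2 * h\<^sup>2"
      proof -
        have "a + 2 * b + e - 2 * k + g \<le> a + 2 * b' + e' + k' + g'"
          if "b \<le> b'" "- 2 * k \<le> k'" "g \<le> g'" "e \<le> e'" for a b b' e e' k k' g g' :: real
          using that by linarith
        from this[OF 1 2 3 4] show ?thesis .
      qed
      also have "\<dots> = (1 + 2 * L * h) * (norm u)\<^sup>2 + h * (2 * R * d + v + (2 * R + 1) * \<eta> + h * C)"
        by (simp add: C_def power2_eq_square algebra_simps)
      also have "\<dots> \<le> (1 + 2 * L * h) * (norm u)\<^sup>2 + h * (2 * R * d + v + \<delta>)"
        using elim(1) \<eta>(2) h by (intro add_left_mono mult_left_mono) auto
      finally show "(\<Sum>z\<in>S. pmf (P h x) z * (norm (z - y (t + h)))\<^sup>2)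
        \<le> (1 + 2 * L * h) * (norm (x - y t))\<^sup>2 + h * (2 * R * d + v + \<delta>)" by (simp add: u_def)
    qed
  qed
qed simp

section \<open>Reduction of a supremum to dyadic times\<close>

lemma dyadic_grid_point:
  fixes t :: real
  assumes "0 < T" "0 \<le> t" "t < b" "b \<le> T"
  obtains n k :: nat where "k \<le> 2 ^ n" "t < k * (T / 2 ^ n)" "k * (T / 2 ^ n) < b"
proof -
  have "((\<lambda>n. T / 2 ^ n) \<longlongrightarrow> 0) sequentially"
    by (rule tendsto_divide_0[OF tendsto_const]) (simp add: filterlim_at_top_imp_at_infinity filterlim_pow_at_top filterlim_realpow_sequentially_gt1)
  then obtain n where n: "T / 2 ^ n < b - t"
    using order_tendstoD(2)[of _ 0 sequentially "b - t"] assms by (auto simp: eventually_sequentially)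
  define h where "h = T / 2 ^ n"
  have h: "h > 0" "h < b - t" using assms n by (auto simp: h_def)
  \<comment> \<open>The successor makes \<open>t < k * h\<close> strict even when \<open>t\<close>
    is itself a grid point.\<close>
  define k where "k = Suc (nat \<lfloor>t / h\<rfloor>)"
  have k: "real k = of_int \<lfloor>t / h\<rfloor> + 1" using assms h by (simp add: k_def)
  have "t / h < k" "k \<le> t / h + 1" unfolding k by linarith+
  then have "t < k * h" "k * h \<le> t + h" using h by (auto simp: field_simps)
  then have kh: "t < k * h" "k * h < b" using h by auto
  have "k * h \<le> 2 ^ n * h" using kh assms by (simp add: h_def)
  then have "real k \<le> 2 ^ n" using h by (simp only: mult_le_cancel_right)
  then have "k \<le> 2 ^ n" by (metis of_nat_le_iff of_nat_numeral of_nat_power)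
  with kh show ?thesis using that h_def by blast
qed

text \<open>By right-continuity \<open>f\<close> stays above \<open>a\<close> on some interval to
  the right of \<open>t\<close>, and for \<open>t < T\<close> this interval contains a grid point.
  Uncountably many times are thus reduced to countably many.\<close>

lemma exceeding_at_dyadic_grid_point:
  fixes f :: "real \<Rightarrow> real"
  assumes "0 < T" and rc: "\<And>t. 0 \<le> t \<Longrightarrow> continuous (at_right t) f"
    and "0 \<le> t" "t \<le> T" "a < f t"
  obtains n k :: nat where "k \<le> 2 ^ n" "a < f (k * (T / 2 ^ n))"
proof (cases "t = T")
  case True
  \<comment> \<open>There is no room to the right of \<open>T\<close>, but \<open>T\<close> is
    itself the grid point with \<open>k = 1\<close> and \<open>n = 0\<close>.\<close>
  then show ?thesis using that[of 1 0] assms by simp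
next
  case False
  have "\<forall>\<^sub>F s in at_right t. a < f s"
    using rc[OF \<open>0 \<le> t\<close>] \<open>a < f t\<close> by (intro order_tendstoD) (auto simp: continuous_within)
  then obtain b where b: "t < b" "\<And>s. t < s \<Longrightarrow> s < b \<Longrightarrow> a < f s"
    unfolding eventually_at_right_field by auto
  obtain n k :: nat where "k \<le> 2 ^ n" "t < k * (T / 2 ^ n)" "k * (T / 2 ^ n) < min b T"
    by (rule dyadic_grid_point[of T t "min b T"]) (use assms b(1) False in auto)
  then show ?thesis using that b(2) by auto
qed

text \<open>In the application \<open>L\<close>, \<open>B\<close> and \<open>R\<close> are the same
  for all fleet sizes while \<open>d\<close> and \<open>v\<close> tend to 0. \<open>B\<close> enters
  only terms of second order in the time step, so it is absent from the final bound.\<close>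

locale markov_jump_near_ode =
  fixes M :: "'w measure" and S :: "'a::euclidean_space set" and q :: "'a \<Rightarrow> 'a \<Rightarrow> real"
    and X :: "real \<Rightarrow> 'w \<Rightarrow> 'a" and F :: "'a \<Rightarrow> 'a" and y :: "real \<Rightarrow> 'a" and L B R d v :: real
  assumes mjp: "markov_jump_process M S q X"
    and lip: "L-lipschitz_on UNIV F"
    and ode: "\<And>t. 0 \<le> t \<Longrightarrow> (y has_vector_derivative F (y t)) (at t within {0..})"
    and B: "\<And>t. 0 \<le> t \<Longrightarrow> norm (F (y t)) \<le> B"
    and R: "\<And>x t. x \<in> S \<Longrightarrow> 0 \<le> t \<Longrightarrow> norm (x - y t) \<le> R"
    and drift: "\<And>x. x \<in> S \<Longrightarrow> norm ((\<Sum>z\<in>S - {x}. q x z *\<^sub>R (z - x)) - F x) \<le> d"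
    and var: "\<And>x. x \<in> S \<Longrightarrow> (\<Sum>z\<in>S - {x}. q x z * (norm (z - x))\<^sup>2) \<le> v"
begin

lemma X_measurable: "0 \<le> t \<Longrightarrow> X t \<in> measurable M (count_space S)"
  using mjp by (simp add: markov_jump_process_def)

lemma X_in_S: "0 \<le> t \<Longrightarrow> \<omega> \<in> space M \<Longrightarrow> X t \<omega> \<in> S"
  using measurable_space[OF X_measurable] by simp

lemma prob_space_M: "prob_space M"
  using mjp by (simp add: markov_jump_process_def)

lemma L_nonneg: "0 \<le> L"
  using lip by (rule lipschitz_on_nonneg)

lemma state_pred_sets: "0 \<le> t \<Longrightarrow> {\<omega> \<in> space M. Q (X t \<omega>)} \<in> sets M"
  using vimage_in_past[of t t X M S Q] past_space_sets[of X M S t] X_measurable by blast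

text \<open>The weight \<open>exp (2 * L * h * (m - n))\<close> absorbs the exponential divergence of the flow of \<open>F\<close>,
  the term \<open>(m - n) * h * c\<close> the defect of the drift and the quadratic variation
  of the remaining \<open>m - n\<close> steps.\<close>

lemma grid_deviation_bound:
  fixes m :: nat and h c r \<epsilon> :: real
  assumes trans: "transition_semigroup_with_rates S q P"
    and cond: "\<And>s z. 0 \<le> s \<Longrightarrow> z \<in> S \<Longrightarrow> AE \<omega> in M.
           real_cond_exp M (past M S X s) (indicator (X (s + h) -` {z} \<inter> space M)) \<omega>
             = pmf (P h (X s \<omega>)) z"
    and step: "\<And>x t. x \<in> S \<Longrightarrow> 0 \<le> t \<Longrightarrow> (\<Sum>z\<in>S. pmf (P h x) z * (norm (z - y (t + h)))\<^sup>2)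
      \<le> (1 + 2 * L * h) * (norm (x - y t))\<^sup>2 + h * c"
    and "0 < h" "0 \<le> c" "0 < \<epsilon>" "0 \<le> r"
  shows "measure M {\<omega> \<in> space M. \<exists>k\<le>m. \<epsilon> < norm (X (real k * h) \<omega> - y (real k * h))}
    \<le> measure M {\<omega> \<in> space M. r < norm (X 0 \<omega> - y 0)}
      + (r\<^sup>2 + m * h * c) * exp (2 * L * (m * h)) / \<epsilon>\<^sup>2"
proof -
  interpret prob_space M by (rule prob_space_M)
  have fin: "finite S" using trans by (simp add: transition_semigroup_with_rates_def)
  define V where "V n x = ((norm (x - y (n * h)))\<^sup>2 + (real m - real n) * h * c)
    * exp (2 * L * h * (real m - real n))" for n x
  define W where "W n \<omega> = V n (X (n * h) \<omega>)" for n \<omega>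
  \<comment> \<open>The restriction on \<open>X 0\<close> bounds \<open>W 0\<close> on
    \<open>E 0\<close>; paths that start farther away are counted by the first term of the
    bound.\<close>
  define E where "E n = {\<omega> \<in> space M. norm (X 0 \<omega> - y 0) \<le> r \<and> (\<forall>i<n. W i \<omega> < \<epsilon>\<^sup>2)}" for n
  have V_ge: "(norm (x - y (n * h)))\<^sup>2 \<le> V n x" if "n \<le> m" for n x
  proof -
    have "(norm (x - y (n * h)))\<^sup>2 * 1 \<le> V n x"
      unfolding V_def using that L_nonneg assms(4,5)
      by (intro mult_mono add_increasing2) auto
    then show ?thesis by simp
  qed
  \<comment> \<open>\<open>E (Suc n)\<close> depends on \<open>X\<close> only at the times
    \<open>i * h\<close> with \<open>i \<le> n\<close>. It therefore belongs to the past at time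
    \<open>n * h\<close>, as the Markov property for the step from \<open>n * h\<close>
    requires.\<close>
  have E_past: "E n \<in> sets (past M S X s)" if "\<And>i. i < n \<Longrightarrow> real i * h \<le> s" "0 \<le> s" for n s
    using that
  proof (induction n)
    case 0
    then show ?case
      using vimage_in_past[of 0 s X M S "\<lambda>x. norm (x - y 0) \<le> r"] X_measurable by (simp add: E_def)
  next
    case (Suc n)
    have "E (Suc n) = E n \<inter> {\<omega> \<in> space M. V n (X (n * h) \<omega>) < \<epsilon>\<^sup>2}"
      by (auto simp: E_def W_def less_Suc_eq)
    moreover have "{\<omega> \<in> space M. V n (X (n * h) \<omega>) < \<epsilon>\<^sup>2} \<in> sets (past M S X s)"
      using Suc.prems assms(4) by (intro vimage_in_past X_measurable) auto
    ultimately show ?case using Suc by auto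
  qed
  have E_sets: "E n \<in> sets M" for n
    using E_past[of n "n * h"] past_space_sets(2)[of X M S "n * h"] X_measurable assms(4)
    by (auto intro!: mult_right_mono)
  have W_int: "integrable M (W n)" for n
    unfolding W_def using assms(4)
    by (intro integrable_function_of_state[OF prob_space_M fin] X_measurable) auto
  have "\<epsilon>\<^sup>2 * measure M (E 0 - E (Suc m)) \<le> (LINT \<omega>|M. indicator (E 0) \<omega> * W 0 \<omega>)"
  proof (rule supermartingale_maximal_inequality)
    show "0 \<le> W n \<omega>" if "n \<le> m" for n \<omega>
      using V_ge[OF that] zero_le_power2 order_trans unfolding W_def by blast
    show "E (Suc n) = {\<omega> \<in> E n. W n \<omega> < \<epsilon>\<^sup>2}" for n
      by (auto simp: E_def less_Suc_eq)
    fix n assume n: "n < m"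
    have V_step: "(\<Sum>z\<in>S. pmf (P h x) z * V (Suc n) z) \<le> V n x" if x: "x \<in> S" for x
    proof -
      define e where "e = exp (2 * L * h * (real m - real (Suc n)))"
      have sum1: "sum (pmf (P h x)) S = 1"
        using trans x assms(4) fin by (intro sum_pmf_eq_1) (auto simp: transition_semigroup_with_rates_def)
      have "(\<Sum>z\<in>S. pmf (P h x) z * V (Suc n) z)
        = ((\<Sum>z\<in>S. pmf (P h x) z * (norm (z - y (n * h + h)))\<^sup>2)
            + sum (pmf (P h x)) S * ((real m - real (Suc n)) * h * c)) * e"
        unfolding V_def e_def[symmetric] sum_distrib_right sum.distrib[symmetric]
        by (intro sum.cong refl) (simp add: algebra_simps)
      also have "\<dots> \<le> (((1 + 2 * L * h) * (norm (x - y (n * h)))\<^sup>2 + h * c)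
          + (real m - real (Suc n)) * h * c) * e"
        using step[OF x, of "n * h"] assms(4) by (intro mult_right_mono) (auto simp: sum1 e_def)
      \<comment> \<open>The cost \<open>h * c\<close> of this step is paid by the fall of the
        remaining budget from \<open>m - n\<close> to \<open>m - Suc n\<close> steps.\<close>
      also have "\<dots> = ((1 + 2 * L * h) * (norm (x - y (n * h)))\<^sup>2 + (real m - real n) * h * c) * e"
        by (simp add: algebra_simps)
      \<comment> \<open>Inflating the budget as well lets \<open>1 + 2 * L * h\<close> be pulled out
        of the whole bracket; it is then dominated by \<open>exp (2 * L * h)\<close>, the ratio of
        consecutive weights.\<close>
      also have "\<dots> \<le> ((1 + 2 * L * h) * (norm (x - y (n * h)))\<^sup>2
          + (1 + 2 * L * h) * ((real m - real n) * h * c)) * e"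
      proof (intro mult_right_mono add_left_mono)
        have "0 \<le> (real m - real n) * h * c" using n assms(4,5) by simp
        moreover have "0 \<le> 2 * L * h" using L_nonneg assms(4) by simp
        ultimately show "(real m - real n) * h * c \<le> (1 + 2 * L * h) * ((real m - real n) * h * c)"
          by (simp add: distrib_right)
      qed (simp add: e_def)
      also have "\<dots> = (1 + 2 * L * h) * (((norm (x - y (n * h)))\<^sup>2 + (real m - real n) * h * c) * e)"
        by (simp add: algebra_simps)
      also have "\<dots> \<le> exp (2 * L * h) * (((norm (x - y (n * h)))\<^sup>2 + (real m - real n) * h * c) * e)"
        using n assms(4,5) by (intro mult_right_mono) (auto simp: e_def exp_ge_add_one_self)
      also have "\<dots> = V n x"
        unfolding V_def e_def by (simp add: algebra_simps flip: exp_add)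
      finally show ?thesis .
    qed
    have nh: "real (Suc n) * h = n * h + h" by (simp add: algebra_simps)
    have "(LINT \<omega>|M. indicator (E (Suc n)) \<omega> * W (Suc n) \<omega>)
      = (LINT \<omega>|M. indicator (E (Suc n)) \<omega> * (\<Sum>z\<in>S. pmf (P h (X (n * h) \<omega>)) z * V (Suc n) z))"
      unfolding W_def nh using assms(4)
      by (intro markov_property_integral[OF prob_space_M fin X_measurable cond] E_past)
        (auto intro!: mult_right_mono)
    also have "\<dots> \<le> (LINT \<omega>|M. indicator (E (Suc n)) \<omega> * W n \<omega>)"
    proof (rule integral_mono)
      show "integrable M (\<lambda>\<omega>. indicator (E (Suc n)) \<omega> * W n \<omega>)"
        using integrable_mult_indicator[OF E_sets W_int] by simp
      have "integrable M (\<lambda>\<omega>. \<Sum>z\<in>S. pmf (P h (X (n * h) \<omega>)) z * V (Suc n) z)"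
        using assms(4)
        by (intro integrable_function_of_state[OF prob_space_M fin X_measurable,
              where \<phi>="\<lambda>x. \<Sum>z\<in>S. pmf (P h x) z * V (Suc n) z"]) auto
      from integrable_mult_indicator[OF E_sets this]
      show "integrable M (\<lambda>\<omega>. indicator (E (Suc n)) \<omega> * (\<Sum>z\<in>S. pmf (P h (X (n * h) \<omega>)) z * V (Suc n) z))"
        by simp
      show "indicator (E (Suc n)) \<omega> * (\<Sum>z\<in>S. pmf (P h (X (n * h) \<omega>)) z * V (Suc n) z)
          \<le> indicator (E (Suc n)) \<omega> * W n \<omega>" if "\<omega> \<in> space M" for \<omega>
        using V_step[OF X_in_S[OF _ that]] assms(4) by (intro mult_left_mono) (auto simp: W_def)
    qed
    finally show "(LINT \<omega>|M. indicator (E (Suc n)) \<omega> * W (Suc n) \<omega>)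
        \<le> (LINT \<omega>|M. indicator (E (Suc n)) \<omega> * W n \<omega>)" .
  qed (use W_int E_sets in auto)
  also have "\<dots> \<le> (LINT \<omega>|M. (r\<^sup>2 + m * h * c) * exp (2 * L * (m * h)))"
  proof (rule integral_mono)
    show "integrable M (\<lambda>\<omega>. indicator (E 0) \<omega> * W 0 \<omega>)"
      using integrable_mult_indicator[OF E_sets W_int] by simp
    show "indicator (E 0) \<omega> * W 0 \<omega> \<le> (r\<^sup>2 + m * h * c) * exp (2 * L * (m * h))" for \<omega>
      using assms(4,5,7)
      by (auto simp: indicator_def E_def W_def V_def mult_ac intro!: mult_left_mono power_mono)
  qed simp
  also have "\<dots> = (r\<^sup>2 + m * h * c) * exp (2 * L * (m * h))" by (simp add: prob_space)
  finally have main: "measure M (E 0 - E (Suc m)) \<le> (r\<^sup>2 + m * h * c) * exp (2 * L * (m * h)) / \<epsilon>\<^sup>2"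
    using \<open>0 < \<epsilon>\<close> by (simp add: field_simps)
  let ?Q = "{\<omega> \<in> space M. r < norm (X 0 \<omega> - y 0)}"
  have Q: "?Q \<in> sets M" by (rule state_pred_sets) simp
  have "measure M {\<omega> \<in> space M. \<exists>k\<le>m. \<epsilon> < norm (X (real k * h) \<omega> - y (real k * h))}
      \<le> measure M (?Q \<union> (E 0 - E (Suc m)))"
  proof (rule finite_measure_mono)
    \<comment> \<open>A deviation above \<open>\<epsilon>\<close> at time \<open>k * h\<close>
      forces \<open>W k\<close> above \<open>\<epsilon>\<^sup>2\<close>, because the weight is at
      least 1 and the budget nonnegative. Such a path is not in \<open>E (Suc m)\<close>.\<close>
    show "{\<omega> \<in> space M. \<exists>k\<le>m. \<epsilon> < norm (X (real k * h) \<omega> - y (real k * h))} \<subseteq> ?Q \<union> (E 0 - E (Suc m))"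
    proof safe
      fix \<omega> and k :: nat assume w: "\<omega> \<in> space M" and k: "k \<le> m" "\<epsilon> < norm (X (k * h) \<omega> - y (k * h))"
        and n: "\<omega> \<notin> E 0"
      then show "r < norm (X 0 \<omega> - y 0)" by (auto simp: E_def)
    next
      fix \<omega> and k :: nat assume w: "\<omega> \<in> space M" and k: "k \<le> m" "\<epsilon> < norm (X (k * h) \<omega> - y (k * h))"
        and "\<omega> \<in> E (Suc m)"
      then have "W k \<omega> < \<epsilon>\<^sup>2" by (auto simp: E_def)
      moreover have "\<epsilon>\<^sup>2 < (norm (X (k * h) \<omega> - y (k * h)))\<^sup>2"
        using k \<open>0 < \<epsilon>\<close> by (intro power_strict_mono) auto
      ultimately show "r < norm (X 0 \<omega> - y 0)"
        using V_ge[OF k(1), of "X (k * h) \<omega>"] by (simp add: W_def)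
    qed
  qed (use Q E_sets in auto)
  also have "\<dots> \<le> measure M ?Q + measure M (E 0 - E (Suc m))"
    by (rule measure_Un_le) (use Q E_sets in auto)
  finally show ?thesis using main by linarith
qed

text \<open>The dyadic grids are nested, so the events \<open>G n\<close> increase and their
  probabilities converge to that of the union. Each grid has \<open>m * h = T\<close>, so for fixed
  \<open>\<delta>\<close> all sufficiently fine grids obey one and the same bound, which passes to
  the union; \<open>\<delta>\<close> tends to 0 last.\<close>

lemma sup_deviation_bound:
  assumes T: "0 < T" and \<epsilon>: "0 < \<epsilon>" and r: "0 \<le> r" and v0: "0 \<le> v"
  shows "measure M {\<omega> \<in> space M. (SUP t\<in>{0..T}. norm (X t \<omega> - y t)) > \<epsilon>}
    \<le> measure M {\<omega> \<in> space M. r < norm (X 0 \<omega> - y 0)}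
      + (r\<^sup>2 + T * (2 * R * d + v)) * exp (2 * L * T) / \<epsilon>\<^sup>2" (is "?lhs \<le> ?m0 + ?b")
proof -
  interpret prob_space M by (rule prob_space_M)
  obtain P where trans: "transition_semigroup_with_rates S q P"
    and cond: "\<And>s h z. 0 \<le> s \<Longrightarrow> 0 \<le> h \<Longrightarrow> z \<in> S \<Longrightarrow> AE \<omega> in M.
           real_cond_exp M (past M S X s) (indicator (X (s + h) -` {z} \<inter> space M)) \<omega>
             = pmf (P h (X s \<omega>)) z"
    using mjp unfolding markov_jump_process_def by blast
  \<comment> \<open>A probability space is nonempty, which supplies a state witnessing that
    \<open>R\<close> and \<open>d\<close> are nonnegative; the grid bound needs a nonnegative cost
    per step.\<close>
  obtain \<omega>0 where "\<omega>0 \<in> space M" using not_empty by blast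
  then have x0: "X 0 \<omega>0 \<in> S" by (intro X_in_S) auto
  have R0: "0 \<le> R" using R[OF x0, of 0] norm_ge_zero order_trans by blast
  have d0: "0 \<le> d" using drift[OF x0] norm_ge_zero order_trans by blast
  define h where "h n = T / 2 ^ n" for n :: nat
  define G where "G n = {\<omega> \<in> space M. \<exists>k\<le>2^n. \<epsilon> < norm (X (real k * h n) \<omega> - y (real k * h n))}" for n
  have h: "0 < h n" for n using T by (simp add: h_def)
  have G_sets: "G n \<in> sets M" for n
  proof -
    have "G n = (\<Union>k\<in>{..2^n}. {\<omega> \<in> space M. \<epsilon> < norm (X (real k * h n) \<omega> - y (real k * h n))})"
      by (auto simp: G_def)
    also have "\<dots> \<in> sets M"
      using less_imp_le[OF h]
      by (intro sets.finite_UN state_pred_sets[where Q="\<lambda>x. \<epsilon> < norm (x - y t)" for t]) auto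
    finally show ?thesis .
  qed
  have "incseq G"
  proof (rule incseq_SucI, rule subsetI)
    fix n \<omega> assume "\<omega> \<in> G n"
    then obtain k :: nat where k: "\<omega> \<in> space M" "k \<le> 2 ^ n" "\<epsilon> < norm (X (k * h n) \<omega> - y (k * h n))"
      by (auto simp: G_def)
    have "k * h n = real (2 * k) * h (Suc n)" by (simp add: h_def)
    then show "\<omega> \<in> G (Suc n)"
      using k unfolding G_def by (intro CollectI conjI exI[of _ "2 * k"]) (auto simp: mult_ac)
  qed
  then have lim: "(\<lambda>n. measure M (G n)) \<longlonglongrightarrow> measure M (\<Union>n. G n)"
    using G_sets by (intro finite_Lim_measure_incseq) auto
  \<comment> \<open>Equality holds as well, since the grid times lie in \<open>{0..T}\<close> and
    deviations are bounded by \<open>R\<close>; so the event is measurable and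
    \<open>measure\<close> gives its true probability.\<close>
  have sub: "{\<omega> \<in> space M. (SUP t\<in>{0..T}. norm (X t \<omega> - y t)) > \<epsilon>} \<subseteq> (\<Union>n. G n)"
  proof safe
    fix \<omega> assume w: "\<omega> \<in> space M" and s: "\<epsilon> < (SUP t\<in>{0..T}. norm (X t \<omega> - y t))"
    have "bdd_above ((\<lambda>t. norm (X t \<omega> - y t)) ` {0..T})"
      using R X_in_S[OF _ w] by (intro bdd_aboveI2[of _ _ R]) auto
    then obtain t where t: "t \<in> {0..T}" "\<epsilon> < norm (X t \<omega> - y t)"
      using s T by (subst (asm) less_cSUP_iff) auto
    have rc: "continuous (at_right t) (\<lambda>s. norm (X s \<omega> - y s))" if "0 \<le> t" for t
    proof -
      have "continuous (at t within {0..}) y"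
        using ode[OF that] by (rule has_vector_derivative_continuous)
      then have "continuous (at_right t) y"
        by (rule continuous_within_subset) (use that in auto)
      moreover have "continuous (at_right t) (\<lambda>s. X s \<omega>)"
        using mjp w that by (simp add: markov_jump_process_def)
      ultimately show ?thesis by (intro continuous_intros)
    qed
    obtain n k :: nat where "k \<le> 2 ^ n" "\<epsilon> < norm (X (k * (T / 2 ^ n)) \<omega> - y (k * (T / 2 ^ n)))"
      by (rule exceeding_at_dyadic_grid_point[where f="\<lambda>s. norm (X s \<omega> - y s)" and t=t and T=T and a=\<epsilon>])
        (use t T rc in auto)
    then show "\<omega> \<in> (\<Union>n. G n)" using w by (auto simp: G_def h_def)
  qed
  have bound: "measure M (\<Union>n. G n) \<le> ?m0 + (r\<^sup>2 + T * (2 * R * d + v + \<delta>)) * exp (2 * L * T) / \<epsilon>\<^sup>2"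
    if "0 < \<delta>" for \<delta>
  proof (rule LIMSEQ_le_const2[OF lim])
    have h_lim: "filterlim h (at_right 0) sequentially"
    proof -
      have "(h \<longlongrightarrow> 0) sequentially" unfolding h_def
        by (rule tendsto_divide_0[OF tendsto_const]) (simp add: filterlim_at_top_imp_at_infinity filterlim_pow_at_top filterlim_realpow_sequentially_gt1)
      then show ?thesis using h by (simp add: tendsto_imp_filterlim_at_right)
    qed
    have "\<forall>\<^sub>F n in sequentially. \<forall>x\<in>S. \<forall>t\<ge>0.
        (\<Sum>z\<in>S. pmf (P (h n) x) z * (norm (z - y (t + h n)))\<^sup>2)
          \<le> (1 + 2 * L * h n) * (norm (x - y t))\<^sup>2 + h n * (2 * R * d + v + \<delta>)"
      using mean_sq_deviation_step[OF trans lip ode B R drift var that]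
      by (rule eventually_compose_filterlim[OF _ h_lim])
    then obtain N where N: "\<And>n x t. N \<le> n \<Longrightarrow> x \<in> S \<Longrightarrow> 0 \<le> t \<Longrightarrow>
        (\<Sum>z\<in>S. pmf (P (h n) x) z * (norm (z - y (t + h n)))\<^sup>2)
          \<le> (1 + 2 * L * h n) * (norm (x - y t))\<^sup>2 + h n * (2 * R * d + v + \<delta>)"
      unfolding eventually_sequentially by blast
    have "measure M (G n) \<le> ?m0 + (r\<^sup>2 + T * (2 * R * d + v + \<delta>)) * exp (2 * L * T) / \<epsilon>\<^sup>2"
      if n: "N \<le> n" for n
    proof -
      have m: "real (2 ^ n) * h n = T" by (simp add: h_def)
      show ?thesis
        unfolding G_def
        using grid_deviation_bound[OF trans cond N[OF n] h[of n] _ \<epsilon> r, of "2 ^ n", unfolded m]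
          less_imp_le[OF h[of n]] R0 d0 v0 \<open>0 < \<delta>\<close> by auto
    qed
    then show "\<exists>N. \<forall>n\<ge>N. measure M (G n) \<le> ?m0 + (r\<^sup>2 + T * (2 * R * d + v + \<delta>)) * exp (2 * L * T) / \<epsilon>\<^sup>2"
      by blast
  qed
  have "measure M (\<Union>n. G n) \<le> ?m0 + ?b"
  proof (rule field_le_epsilon)
    fix e :: real assume e: "0 < e"
    \<comment> \<open>Chosen so that \<open>\<delta>\<close> contributes exactly \<open>e\<close> to
      the bound.\<close>
    define \<delta> where "\<delta> = e * \<epsilon>\<^sup>2 / (T * exp (2 * L * T))"
    have "0 < \<delta>" using e \<epsilon> T by (simp add: \<delta>_def)
    from bound[OF this] show "measure M (\<Union>n. G n) \<le> ?m0 + ?b + e"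
    proof (rule order_trans)
      have "T * \<delta> * exp (2 * L * T) / \<epsilon>\<^sup>2 = e" using \<epsilon> T by (simp add: \<delta>_def)
      then show "?m0 + (r\<^sup>2 + T * (2 * R * d + v + \<delta>)) * exp (2 * L * T) / \<epsilon>\<^sup>2 \<le> ?m0 + ?b + e"
        by (simp add: algebra_simps add_divide_distrib)
    qed
  qed
  moreover have "?lhs \<le> measure M (\<Union>n. G n)"
    using sub G_sets by (intro finite_measure_mono) auto
  ultimately show ?thesis by linarith
qed

end

section \<open>The field and the jump rates of the scooter fleet\<close>

text \<open>Being closed and convex, this set admits a nearest-point projection that is 1-Lipschitz;
  it contains all states of the fleet and, unlike \<open>fluid_domain\<close>, keeps the denominator
  of the field away from 0.\<close>

definition prob_simplex :: "(real ^ 'k::finite) set" where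
  "prob_simplex = {y. (\<forall>k. 0 \<le> y $ k) \<and> (\<Sum>k\<in>UNIV. y $ k) = 1}"

lemma convex_prob_simplex: "convex (prob_simplex :: (real ^ 'k::finite) set)"
proof (rule convexI)
  fix x y :: "real ^ 'k" and u v :: real
  assume "x \<in> prob_simplex" "y \<in> prob_simplex" "0 \<le> u" "0 \<le> v" "u + v = 1"
  then show "u *\<^sub>R x + v *\<^sub>R y \<in> prob_simplex"
    by (simp add: prob_simplex_def sum.distrib flip: sum_distrib_left)
qed

lemma closed_prob_simplex: "closed (prob_simplex :: (real ^ 'k::finite) set)"
proof -
  have "prob_simplex = (\<Inter>k. {y :: real ^ 'k. 0 \<le> y $ k}) \<inter> {y. (\<Sum>k\<in>UNIV. y $ k) = 1}"
    by (auto simp: prob_simplex_def)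
  also have "closed \<dots>"
    by (intro closed_Int closed_INT ballI closed_Collect_le closed_Collect_eq continuous_intros)
  finally show ?thesis .
qed

lemma prob_simplex_nonempty: "(prob_simplex :: (real ^ 'k::finite) set) \<noteq> {}"
proof -
  have "axis undefined 1 \<in> (prob_simplex :: (real ^ 'k) set)"
    by (auto simp: prob_simplex_def axis_def)
  then show ?thesis by blast
qed

lemma prob_simplex_component_le_1: "y \<in> prob_simplex \<Longrightarrow> y $ k \<le> 1"
  using member_le_sum[of k UNIV "\<lambda>k. y $ k"] by (simp add: prob_simplex_def)

lemma norm_prob_simplex_le_1: "y \<in> prob_simplex \<Longrightarrow> norm y \<le> 1"
  using norm_le_l1_cart[of y] by (simp add: prob_simplex_def)

lemma norm_axis_diff_le: "norm (axis i 1 - axis k 1 :: real ^ 'k::finite) \<le> 2"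
  using norm_triangle_ineq4[of "axis i 1 :: real ^ 'k" "axis k 1"] by (simp add: norm_axis_1)

lemma scooter_states_subset_prob_simplex: "scooter_states N \<subseteq> (prob_simplex :: (real ^ 'k::{finite,linorder}) set)"
proof
  fix y :: "(real, 'k) vec" assume y: "y \<in> scooter_states N"
  have "0 \<le> y $ k" for k
  proof -
    have "\<exists>m::nat. y $ k = real m / real N" using y by (simp add: scooter_states_def)
    then show ?thesis by auto
  qed
  then show "y \<in> prob_simplex" using y by (simp add: prob_simplex_def scooter_states_def)
qed

text \<open>A scooter can leave interval \<open>k\<close> only if one is there:
  \<open>x $ k \<noteq> 0\<close> makes the count \<open>m k\<close> positive, so the truncated
  subtraction \<open>m k - 1\<close> is exact.\<close>

lemma scooter_states_jump:
  fixes x :: "real ^ 'k::{finite,linorder}"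
  assumes x: "x \<in> scooter_states N" and "x $ k \<noteq> 0" "i \<noteq> k"
  shows "x + (1 / real N) *\<^sub>R (axis i 1 - axis k 1) \<in> scooter_states N"
proof -
  obtain m :: "'k \<Rightarrow> nat" where m: "\<And>l. x $ l = real (m l) / real N"
    using x unfolding scooter_states_def by (auto dest!: choice)
  have "m k \<noteq> 0" using m[of k] assms(2) by auto
  then have mk: "real (m k - 1) = real (m k) - 1" by (simp add: of_nat_diff)
  let ?x' = "x + (1 / real N) *\<^sub>R (axis i 1 - axis k 1)"
  have "?x' $ l = real (if l = i then m l + 1 else if l = k then m l - 1 else m l) / real N" for l
    using assms(3) mk by (auto simp: m axis_def add_divide_distrib diff_divide_distrib)
  moreover have "(\<Sum>l\<in>UNIV. ?x' $ l) = 1"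
    using x by (simp add: scooter_states_def sum.distrib sum_subtractf axis_def diff_divide_distrib
        flip: sum_divide_distrib)
  ultimately show ?thesis unfolding scooter_states_def by blast
qed

text \<open>The target \<open>x + v\<close> differs from the excluded point \<open>x\<close>, and it
  lies in \<open>S\<close> whenever the rate is nonzero, so exactly one term survives.\<close>

lemma sum_point_mass_rate:
  fixes \<phi> :: "'a::ab_group_add \<Rightarrow> 'b::real_vector"
  assumes "finite S" "v \<noteq> 0" "r \<noteq> 0 \<Longrightarrow> x + v \<in> S"
  shows "(\<Sum>z\<in>S - {x}. (if z = x + v then r else 0) *\<^sub>R \<phi> (z - x)) = r *\<^sub>R \<phi> v"
proof -
  have "(\<Sum>z\<in>S - {x}. (if z = x + v then r else 0) *\<^sub>R \<phi> (z - x))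
      = (\<Sum>z\<in>S - {x}. if z = x + v then r *\<^sub>R \<phi> v else 0)"
    by (intro sum.cong) auto
  also have "\<dots> = r *\<^sub>R \<phi> v" using assms by (cases "r = 0") (auto simp: sum.delta)
  finally show ?thesis .
qed

locale escooter_fleet =
  fixes lam mu :: real and KU :: "'k::{finite,linorder}"
    and g :: "'k \<Rightarrow> real" and p :: "'k \<Rightarrow> 'k \<Rightarrow> real"
  assumes lam: "0 < lam" and mu: "0 < mu" and g_pos: "\<And>k. 0 < g k"
    and p_nonneg: "\<And>i j. j \<le> i \<Longrightarrow> 0 \<le> p i j"
    and p_zero: "\<And>i j. i < j \<Longrightarrow> p i j = 0"
    and p_sum: "\<And>i. KU \<le> i \<Longrightarrow> (\<Sum>j\<le>i. p i j) = 1"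
begin

definition weight :: "(real, 'k) vec \<Rightarrow> real" where
  "weight y = (\<Sum>i\<in>UNIV. y $ i * g i)"

text \<open>Mean velocity caused by rides, per unit of mass in interval \<open>k\<close>.\<close>

definition ride_drift :: "'k \<Rightarrow> (real, 'k) vec" where
  "ride_drift k = (\<Sum>j\<le>k. (mu * p k j * of_bool (KU \<le> k)) *\<^sub>R (axis j 1 - axis k 1))"

abbreviation field :: "real \<Rightarrow> (real, 'k) vec \<Rightarrow> (real, 'k) vec" where
  "field \<equiv> fluid_field lam mu KU g p"

text \<open>Rides act linearly on \<open>y\<close>. Swaps act through an average of jump directions
  whose weights are the shares \<open>y $ k * g k / weight y\<close>, and only this part contains
  \<open>gam\<close>.\<close>

lemma field_split: "field gam y = (\<Sum>k\<in>UNIV. y $ k *\<^sub>R ride_drift k)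
   + (lam * gam) *\<^sub>R (\<Sum>k\<in>UNIV. (y $ k * g k / weight y) *\<^sub>R (axis last_interval 1 - axis k 1))"
  by (simp add: fluid_field_def ride_drift_def weight_def scaleR_add_right sum.distrib
      scaleR_sum_right mult_ac)

text \<open>Every direction \<open>axis i 1 - axis k 1\<close> has coordinate sum 0: scooters are
  moved, never created.\<close>

lemma sum_field: "(\<Sum>j\<in>UNIV. field gam y $ j) = 0"
proof -
  have ax: "(\<Sum>j\<in>UNIV. (axis i 1 - axis k 1 :: (real, 'k) vec) $ j) = 0" for i k
    by (simp add: sum_subtractf axis_def)
  have "(\<Sum>j\<in>UNIV. ride_drift k $ j) = 0" for k
    unfolding ride_drift_def sum_component vector_scaleR_component
    by (subst sum.swap) (simp only: ax real_scaleR_def sum_distrib_left[symmetric], simp)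
  then show ?thesis
    unfolding field_split sum_component vector_scaleR_component vector_add_component sum.distrib
      real_scaleR_def sum_distrib_left[symmetric]
    by (subst (1 2) sum.swap) (simp only: ax sum_distrib_left[symmetric], simp)
qed

lemma p_le_last: "mu * p k j * of_bool (KU \<le> k) = (if max KU j \<le> k then mu * p k j else 0)"
  using p_zero[of k j] by (cases "k < j") auto

text \<open>The row sums of \<open>p\<close> turn the outflow by rides into
  \<open>mu * y $ j\<close>, and the shares sum to 1, which gives the constant inflow at
  \<open>last_interval\<close>. Rides ending in their own interval are counted in both inflow and
  outflow and cancel.\<close>

lemma field_component:
  assumes "weight y \<noteq> 0"
  shows "field gam y $ j = (\<Sum>k\<in>{max KU j..}. mu * p k j * y $ k)
    + lam * gam * of_bool (j = last_interval)
    - mu * y $ j * of_bool (KU \<le> j) - lam * gam * y $ j * g j / weight y"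
proof -
  have rd: "ride_drift k $ j = (if max KU j \<le> k then mu * p k j else 0)
      - mu * of_bool (KU \<le> k) * of_bool (j = k)" for k
  proof -
    have "ride_drift k $ j = (\<Sum>i\<le>k. mu * p k i * of_bool (KU \<le> k) * of_bool (i = j))
        - (\<Sum>i\<le>k. mu * p k i * of_bool (KU \<le> k)) * of_bool (j = k)"
      unfolding ride_drift_def sum_component sum_distrib_right sum_subtractf[symmetric]
      by (intro sum.cong) (auto simp: axis_def algebra_simps)
    also have "(\<Sum>i\<le>k. mu * p k i * of_bool (KU \<le> k) * of_bool (i = j))
        = (\<Sum>i\<le>k. if i = j then mu * p k j * of_bool (KU \<le> k) else 0)"
      by (intro sum.cong) auto
    also have "\<dots> = mu * p k j * of_bool (KU \<le> k)"
      using p_zero[of k j] by (auto simp: sum.delta)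
    also have "(\<Sum>i\<le>k. mu * p k i * of_bool (KU \<le> k)) = mu * of_bool (KU \<le> k)"
      using p_sum[of k] by (auto simp: sum_distrib_left[symmetric])
    finally show ?thesis using p_le_last[of k j] by simp
  qed
  have "(\<Sum>k\<in>UNIV. y $ k * ride_drift k $ j)
      = (\<Sum>k\<in>UNIV. if max KU j \<le> k then mu * p k j * y $ k else 0)
        - (\<Sum>k\<in>UNIV. if k = j then mu * y $ j * of_bool (KU \<le> j) else 0)"
    unfolding rd sum_subtractf[symmetric] by (intro sum.cong) (auto simp: algebra_simps)
  also have "(\<Sum>k\<in>UNIV. if max KU j \<le> k then mu * p k j * y $ k else 0)
      = (\<Sum>k\<in>{max KU j..}. mu * p k j * y $ k)"
    by (intro sum.mono_neutral_cong_right) auto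
  finally have 1: "(\<Sum>k\<in>UNIV. y $ k * ride_drift k $ j)
      = (\<Sum>k\<in>{max KU j..}. mu * p k j * y $ k) - mu * y $ j * of_bool (KU \<le> j)"
    by simp
  have "(\<Sum>k\<in>UNIV. y $ k * g k / weight y * (axis last_interval 1 - axis k 1 :: (real, 'k) vec) $ j)
      = (\<Sum>k\<in>UNIV. y $ k * g k) / weight y * of_bool (j = last_interval)
        - (\<Sum>k\<in>UNIV. if k = j then y $ j * g j / weight y else 0)"
    unfolding sum_divide_distrib sum_distrib_right sum_subtractf[symmetric]
    by (intro sum.cong) (auto simp: axis_def)
  also have "(\<Sum>k\<in>UNIV. y $ k * g k) / weight y = 1"
    using assms by (simp add: weight_def)
  finally have 2: "(\<Sum>k\<in>UNIV. y $ k * g k / weight y * (axis last_interval 1 - axis k 1 :: (real, 'k) vec) $ j)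
      = of_bool (j = last_interval) - y $ j * g j / weight y"
    by simp
  show ?thesis
    unfolding field_split vector_add_component sum_component vector_scaleR_component real_scaleR_def 1 2
    by (simp add: algebra_simps)
qed

lemma norm_swap_direction_le:
  assumes "y \<in> prob_simplex"
  shows "norm (\<Sum>k\<in>UNIV. (y $ k * g k / weight y) *\<^sub>R (axis last_interval 1 - axis k 1 :: (real, 'k) vec)) \<le> 2"
proof -
  have w0: "0 \<le> y $ k * g k" for k
    using assms g_pos[of k] by (simp add: prob_simplex_def)
  then have w: "0 \<le> weight y" by (simp add: weight_def sum_nonneg)
  have "norm (\<Sum>k\<in>UNIV. (y $ k * g k / weight y) *\<^sub>R (axis last_interval 1 - axis k 1 :: (real, 'k) vec))
      \<le> (\<Sum>k\<in>UNIV. (y $ k * g k / weight y) * 2)"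
    using w0 w norm_axis_diff_le
    by (intro sum_norm_le) (simp only: norm_scaleR, intro mult_mono, auto)
  also have "\<dots> = (\<Sum>k\<in>UNIV. y $ k * g k) / weight y * 2"
    by (simp only: sum_divide_distrib sum_distrib_right)
  also have "\<dots> = weight y / weight y * 2" by (simp only: weight_def)
  \<comment> \<open>Because \<open>x / 0 = 0\<close>, this requires no case distinction on whether
    \<open>weight y\<close> vanishes.\<close>
  also have "\<dots> \<le> 2" by simp
  finally show ?thesis .
qed

text \<open>Only the swap part depends on \<open>gam\<close>. Comparing \<open>Nst N / N\<close>
  with its limit in this way yields the drift defect \<open>d\<close>.\<close>

lemma norm_field_diff_le:
  assumes "y \<in> prob_simplex"
  shows "norm (field gam y - field gam' y) \<le> 2 * lam * \<bar>gam - gam'\<bar>"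
proof -
  have "field gam y - field gam' y = (lam * (gam - gam')) *\<^sub>R
      (\<Sum>k\<in>UNIV. (y $ k * g k / weight y) *\<^sub>R (axis last_interval 1 - axis k 1))"
    by (simp add: field_split algebra_simps)
  then have "norm (field gam y - field gam' y) \<le> \<bar>lam * (gam - gam')\<bar> * 2"
    using norm_swap_direction_le[OF assms] by (auto intro!: mult_left_mono)
  then show ?thesis using lam by (simp add: abs_mult)
qed

text \<open>On the simplex \<open>weight y\<close> is an average of the values of \<open>g\<close>,
  hence at least their minimum.\<close>

lemma weight_bounds:
  obtains a b where "0 < a" "0 < b" "\<And>k. g k \<le> b"
    and "\<And>y. y \<in> prob_simplex \<Longrightarrow> a \<le> weight y"
proof
  show "0 < Min (range g)" using g_pos by simp
  show "g k \<le> Max (range g)" for k by simp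
  then show "0 < Max (range g)" using g_pos less_le_trans by blast
  fix y :: "(real, 'k) vec" assume y: "y \<in> prob_simplex"
  have "(\<Sum>i\<in>UNIV. y $ i * Min (range g)) \<le> weight y"
    unfolding weight_def using y by (intro sum_mono mult_left_mono) (auto simp: prob_simplex_def)
  then show "Min (range g) \<le> weight y"
    using y by (simp add: prob_simplex_def flip: sum_distrib_right)
qed

text \<open>Only the shares are nonlinear. Their difference consists of the change of the numerator,
  at most \<open>b * norm (y - z)\<close>, and the change of the weight, at most
  \<open>CARD('k) * b * norm (y - z)\<close>, multiplied by a share of at most 1. Division by
  \<open>weight y \<ge> a\<close> gives \<open>C\<close>.\<close>

lemma field_lipschitz:
  obtains L where "L-lipschitz_on prob_simplex (field gam)"
proof -
  obtain a b where ab: "0 < a" "0 < b" "\<And>k. g k \<le> b" "\<And>y. y \<in> prob_simplex \<Longrightarrow> a \<le> weight y"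
    using weight_bounds by blast
  define C where "C = (b + CARD('k) * b) / a"
  have share: "\<bar>y $ k * g k / weight y - z $ k * g k / weight z\<bar> \<le> C * norm (y - z)"
    if y: "y \<in> prob_simplex" and z: "z \<in> prob_simplex" for y z k
  proof -
    have wy: "0 < weight y" "a \<le> weight y" and wz: "0 < weight z"
      using ab(1) ab(4)[OF y] ab(4)[OF z] by auto
    have comp: "\<bar>y $ i * g i - z $ i * g i\<bar> \<le> b * norm (y - z)" for i
    proof -
      have "\<bar>y $ i * g i - z $ i * g i\<bar> = g i * \<bar>(y - z) $ i\<bar>"
        using g_pos[of i] by (simp add: abs_mult flip: left_diff_distrib)
      also have "\<dots> \<le> b * norm (y - z)"
        using ab(2,3) component_le_norm_cart[of "y - z" i] by (intro mult_mono) auto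
      finally show ?thesis .
    qed
    have "\<bar>weight y - weight z\<bar> \<le> (\<Sum>i\<in>UNIV. \<bar>y $ i * g i - z $ i * g i\<bar>)"
      unfolding weight_def sum_subtractf[symmetric] by (rule sum_abs)
    also have "\<dots> \<le> (\<Sum>i\<in>(UNIV::'k set). b * norm (y - z))" by (intro sum_mono comp)
    finally have dw: "\<bar>weight y - weight z\<bar> \<le> CARD('k) * b * norm (y - z)" by simp
    have z0: "0 \<le> z $ i * g i" for i
      using z less_imp_le[OF g_pos[of i]] by (simp add: prob_simplex_def)
    then have zk: "0 \<le> z $ k * g k" "z $ k * g k \<le> weight z"
      unfolding weight_def by (auto intro: member_le_sum[of k UNIV "\<lambda>i. z $ i * g i"])
    have "y $ k * g k / weight y - z $ k * g k / weight z
        = ((y $ k * g k - z $ k * g k) + (z $ k * g k / weight z) * (weight z - weight y)) / weight y"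
      using wy wz by (simp add: field_simps)
    then have "\<bar>y $ k * g k / weight y - z $ k * g k / weight z\<bar>
        = \<bar>(y $ k * g k - z $ k * g k) + (z $ k * g k / weight z) * (weight z - weight y)\<bar> / weight y"
      using wy by simp
    also have "\<dots> \<le> (\<bar>y $ k * g k - z $ k * g k\<bar> + (z $ k * g k / weight z) * \<bar>weight z - weight y\<bar>) / weight y"
      using wy wz zk
      by (intro divide_right_mono order_trans[OF abs_triangle_ineq] add_mono order_refl)
        (simp_all only: abs_mult abs_of_nonneg divide_nonneg_pos less_imp_le order_refl)
    also have "\<dots> \<le> (b * norm (y - z) + 1 * (CARD('k) * b * norm (y - z))) / weight y"
      using wy wz zk comp dw by (intro divide_right_mono add_mono mult_mono) (auto simp: abs_minus_commute)
    also have "\<dots> \<le> (b * norm (y - z) + 1 * (CARD('k) * b * norm (y - z))) / a"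
      using wy ab(1,2) by (intro divide_left_mono) auto
    also have "\<dots> = C * norm (y - z)" by (simp add: C_def algebra_simps add_divide_distrib)
    finally show ?thesis .
  qed
  have C0: "0 \<le> C" using ab by (simp add: C_def)
  define L where "L = (\<Sum>k\<in>UNIV. norm (ride_drift k)) + \<bar>lam * gam\<bar> * (CARD('k) * (C * 2))"
  have "L-lipschitz_on prob_simplex (field gam)"
  proof (rule lipschitz_onI)
    show "0 \<le> L" using C0 by (simp add: L_def sum_nonneg)
    fix y z :: "(real, 'k) vec" assume y: "y \<in> prob_simplex" and z: "z \<in> prob_simplex"
    let ?e = "\<lambda>k. axis last_interval 1 - axis k 1 :: (real, 'k) vec"
    have diff: "field gam y - field gam z = (\<Sum>k\<in>UNIV. ((y - z) $ k) *\<^sub>R ride_drift k)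
        + (lam * gam) *\<^sub>R (\<Sum>k\<in>UNIV. (y $ k * g k / weight y - z $ k * g k / weight z) *\<^sub>R ?e k)"
      by (simp add: field_split scaleR_left_diff_distrib sum_subtractf scaleR_right_diff_distrib)
    have "norm (field gam y - field gam z) \<le> norm (\<Sum>k\<in>UNIV. ((y - z) $ k) *\<^sub>R ride_drift k)
        + \<bar>lam * gam\<bar> * norm (\<Sum>k\<in>UNIV. (y $ k * g k / weight y - z $ k * g k / weight z) *\<^sub>R ?e k)"
      unfolding diff norm_scaleR[symmetric] by (rule norm_triangle_ineq)
    also have "\<dots> \<le> (\<Sum>k\<in>UNIV. norm (y - z) * norm (ride_drift k))
        + \<bar>lam * gam\<bar> * (\<Sum>k\<in>(UNIV :: 'k set). (C * norm (y - z)) * 2)"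
    proof (intro add_mono mult_left_mono sum_norm_le)
      show "norm (((y - z) $ k) *\<^sub>R ride_drift k) \<le> norm (y - z) * norm (ride_drift k)" for k
        using component_le_norm_cart[of "y - z" k] by (simp add: mult_right_mono)
      show "norm ((y $ k * g k / weight y - z $ k * g k / weight z) *\<^sub>R ?e k) \<le> (C * norm (y - z)) * 2" for k
        unfolding norm_scaleR using share[OF y z, of k] norm_axis_diff_le C0
        by (intro mult_mono) auto
    qed simp
    also have "\<dots> = L * norm (y - z)"
      by (simp add: L_def distrib_right distrib_left sum_distrib_left sum_distrib_right mult_ac)
    finally show "dist (field gam y) (field gam z) \<le> L * dist y z" by (simp add: dist_norm)
  qed
  then show ?thesis by (rule that)
qed

end

section \<open>Invariance of the simplex under the flow\<close>

lemma has_vector_derivative_vec_nth: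
  fixes y :: "real \<Rightarrow> real ^ 'n::finite"
  assumes "(y has_vector_derivative d) F"
  shows "((\<lambda>t. y t $ k) has_real_derivative d $ k) F"
  using bounded_linear.has_vector_derivative[OF bounded_linear_vec_nth assms]
  by (simp add: has_real_derivative_iff_has_vector_derivative)

lemma has_real_derivative_zero_imp_eq:
  fixes e :: "real \<Rightarrow> real"
  assumes "\<And>t. 0 \<le> t \<Longrightarrow> (e has_real_derivative 0) (at t within {0..})" and "0 \<le> t"
  shows "e t = e 0"
proof (rule antisym)
  show "e t \<le> e 0"
    by (rule has_real_derivative_nonpos_imp_le[where e' = "\<lambda>_. 0"]) (use assms in auto)
  have "- e t \<le> - e 0"
    by (rule has_real_derivative_nonpos_imp_le[where e = "\<lambda>t. - e t" and e' = "\<lambda>_. 0"])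
      (use assms in \<open>auto intro!: derivative_eq_intros\<close>)
  then show "e 0 \<le> e t" by simp
qed

context escooter_fleet
begin

lemma weight_pos:
  assumes "y \<in> prob_simplex"
  shows "0 < weight y"
proof -
  obtain a b where ab: "0 < a" "0 < b" "\<And>k. g k \<le> b"
    "\<And>y. y \<in> prob_simplex \<Longrightarrow> a \<le> weight y"
    using weight_bounds by blast
  show ?thesis using ab(1) ab(4)[OF assms] by linarith
qed

lemma prob_simplex_subset_fluid_domain: "prob_simplex \<subseteq> fluid_domain g"
proof
  fix y :: "(real, 'k) vec" assume y: "y \<in> prob_simplex"
  then have "(\<Sum>i\<in>UNIV. y $ i * g i) \<noteq> 0" using weight_pos[OF y] by (simp add: weight_def)
  then show "y \<in> fluid_domain g"
    using y prob_simplex_component_le_1[OF y] by (simp add: fluid_domain_def prob_simplex_def)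
qed

text \<open>In the componentwise formula each negative term contains \<open>y $ k\<close>, with
  coefficient at most \<open>mu\<close> for rides and \<open>lam * gam * (b / a)\<close> for swaps;
  \<open>C\<close> is the sum of the two. In particular a vanishing coordinate cannot
  decrease.\<close>

lemma field_quasi_positive:
  assumes "0 \<le> gam"
  obtains C where "\<And>y k. y \<in> prob_simplex \<Longrightarrow> 0 \<le> field gam y $ k + C * y $ k"
proof -
  obtain a b where ab: "0 < a" "0 < b" "\<And>k. g k \<le> b" "\<And>y. y \<in> prob_simplex \<Longrightarrow> a \<le> weight y"
    using weight_bounds by blast
  have "0 \<le> field gam y $ k + (mu + lam * gam * (b / a)) * y $ k" if y: "y \<in> prob_simplex" for y k
  proof -
    have w: "0 < weight y" "a \<le> weight y" using ab(1) ab(4)[OF y] by auto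
    have y0: "0 \<le> y $ i" for i using y by (simp add: prob_simplex_def)
    have "0 \<le> (\<Sum>i\<in>{max KU k..}. mu * p i k * y $ i)"
      using mu y0 p_nonneg by (intro sum_nonneg mult_nonneg_nonneg) auto
    moreover have "0 \<le> lam * gam * of_bool (k = last_interval)" using lam assms by simp
    moreover have "mu * y $ k * of_bool (KU \<le> k) \<le> mu * y $ k" using mu y0[of k] by simp
    moreover have "g k / weight y \<le> b / a"
      using ab w g_pos[of k] by (intro frac_le) auto
    then have "lam * gam * y $ k * (g k / weight y) \<le> lam * gam * y $ k * (b / a)"
      using lam assms y0 by (intro mult_left_mono) auto
    ultimately show ?thesis
      using field_component[of y gam k] w by (simp add: algebra_simps)
  qed
  then show ?thesis by (rule that)
qed

text \<open>Off the simplex the field is replaced by a globally Lipschitz one that equals it on the simplex;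
  the term \<open>- C * y\<close> is split off so that what remains is componentwise nonnegative, which
  keeps solutions of the modified equation in the simplex.\<close>

lemma field_extension:
  assumes "0 \<le> gam"
  shows "\<exists>F L. L-lipschitz_on UNIV F \<and> (\<forall>y\<in>prob_simplex. F y = field gam y) \<and>
    (\<forall>y. (\<forall>t\<ge>0. (y has_vector_derivative F (y t)) (at t within {0..}))
      \<longrightarrow> y 0 \<in> prob_simplex \<longrightarrow> (\<forall>t\<ge>0. y t \<in> prob_simplex))"
proof -
  obtain L where L: "L-lipschitz_on prob_simplex (field gam)" by (rule field_lipschitz)
  obtain C where C: "\<And>y k. y \<in> prob_simplex \<Longrightarrow> 0 \<le> field gam y $ k + C * y $ k"
    using field_quasi_positive[OF assms] by blast
  define proj where "proj = closest_point (prob_simplex :: ((real, 'k) vec) set)"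
  have proj_in: "proj y \<in> prob_simplex" for y
    unfolding proj_def by (rule closest_point_in_set[OF closed_prob_simplex prob_simplex_nonempty])
  have proj_id: "proj y = y" if "y \<in> prob_simplex" for y
    unfolding proj_def using that by (rule closest_point_self)
  have proj_lip: "1-lipschitz_on UNIV proj"
    unfolding proj_def
    using closest_point_lipschitz[OF convex_prob_simplex closed_prob_simplex prob_simplex_nonempty]
    by (intro lipschitz_onI) auto
  \<comment> \<open>The two multiples of \<open>C\<close> cancel on the simplex, where
    \<open>proj\<close> is the identity. Elsewhere \<open>- C *\<^sub>R y\<close> is a linear term
    that an integrating factor removes.\<close>
  define F where "F y = field gam (proj y) + C *\<^sub>R proj y - C *\<^sub>R y" for y
  have "(L * 1)-lipschitz_on UNIV (\<lambda>y. field gam (proj y))"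
    by (rule lipschitz_on_compose2[OF proj_lip]) (use L proj_in in \<open>auto intro: lipschitz_on_subset\<close>)
  moreover have "(\<bar>C\<bar> * 1)-lipschitz_on UNIV (\<lambda>y. C *\<^sub>R proj y)"
    by (rule lipschitz_on_cmult[OF proj_lip])
  moreover have "(\<bar>C\<bar> * 1)-lipschitz_on UNIV (\<lambda>y::(real, 'k) vec. C *\<^sub>R y)"
    by (rule lipschitz_on_cmult[OF lipschitz_on_id])
  ultimately have F_lip: "(L * 1 + \<bar>C\<bar> * 1 + \<bar>C\<bar> * 1)-lipschitz_on UNIV F"
    unfolding F_def by (intro lipschitz_on_diff lipschitz_on_add)
  have F_eq: "F y = field gam y" if "y \<in> prob_simplex" for y
    using proj_id[OF that] by (simp add: F_def)
  have F_inv: "y t \<in> prob_simplex"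
    if y: "\<And>t. 0 \<le> t \<Longrightarrow> (y has_vector_derivative F (y t)) (at t within {0..})"
      and y0: "y 0 \<in> prob_simplex" and t: "0 \<le> t" for y t
  proof -
    have F_comp: "F x $ k = (field gam (proj x) $ k + C * proj x $ k) - C * x $ k" for x k
      by (simp add: F_def)
    have exp_der: "((\<lambda>t. exp (C * t)) has_real_derivative C * exp (C * s)) (at s within {0..})" for s
      by (auto intro!: derivative_eq_intros)
    have "0 \<le> y t $ k" for k
    proof -
      \<comment> \<open>The derivative of \<open>exp (C * t) * y t $ k\<close> is nonnegative by the
        choice of \<open>C\<close>, wherever \<open>y t\<close> lies, because \<open>C\<close> is
        applied at \<open>proj (y t)\<close>.\<close>
      have "- (exp (C * t) * y t $ k) \<le> - (exp (C * 0) * y 0 $ k)"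
      proof (rule has_real_derivative_nonpos_imp_le[where e = "\<lambda>t. - (exp (C * t) * y t $ k)"
            and e' = "\<lambda>t. - (exp (C * t) * (field gam (proj (y t)) $ k + C * proj (y t) $ k))"])
        fix s :: real assume s: "0 \<le> s"
        show "((\<lambda>t. - (exp (C * t) * y t $ k)) has_real_derivative
            - (exp (C * s) * (field gam (proj (y s)) $ k + C * proj (y s) $ k))) (at s within {0..})"
          by (rule DERIV_cong[OF DERIV_minus[OF DERIV_mult'[OF exp_der
                has_vector_derivative_vec_nth[OF y[OF s]]]]])
            (simp add: F_comp algebra_simps)
        show "- (exp (C * s) * (field gam (proj (y s)) $ k + C * proj (y s) $ k)) \<le> 0"
          using C[OF proj_in] by simp
      qed (use t in auto)
      moreover have "0 \<le> y 0 $ k" using y0 by (simp add: prob_simplex_def)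
      ultimately have "0 \<le> exp (C * t) * y t $ k" by simp
      then show ?thesis by (simp add: zero_le_mult_iff)
    qed
    moreover have "(\<Sum>k\<in>UNIV. y t $ k) = 1"
    proof -
      \<comment> \<open>The total mass \<open>s\<close> satisfies \<open>s' = C - C * s\<close>,
        since the field conserves mass and \<open>proj\<close> has mass 1. Hence
        \<open>exp (C * t) * (s - 1)\<close> is constant, and it starts at 0.\<close>
      have "exp (C * t) * ((\<Sum>k\<in>UNIV. y t $ k) - 1) = exp (C * 0) * ((\<Sum>k\<in>UNIV. y 0 $ k) - 1)"
      proof (rule has_real_derivative_zero_imp_eq[OF _ t,
            where e = "\<lambda>t. exp (C * t) * ((\<Sum>k\<in>UNIV. y t $ k) - 1)"])
        fix s :: real assume s: "0 \<le> s"
        have "(\<Sum>k\<in>UNIV. F (y s) $ k) = C - C * (\<Sum>k\<in>UNIV. y s $ k)"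
          using proj_in[of "y s"]
          by (simp add: F_comp sum.distrib sum_subtractf sum_field prob_simplex_def flip: sum_distrib_left)
        then have "((\<lambda>t. (\<Sum>k\<in>UNIV. y t $ k) - 1) has_real_derivative
            C - C * (\<Sum>k\<in>UNIV. y s $ k)) (at s within {0..})"
          by (intro DERIV_cong[OF DERIV_diff[OF DERIV_sum[OF
                  has_vector_derivative_vec_nth[OF y[OF s]]] DERIV_const]]) simp
        from DERIV_mult'[OF exp_der this]
        show "((\<lambda>t. exp (C * t) * ((\<Sum>k\<in>UNIV. y t $ k) - 1)) has_real_derivative 0) (at s within {0..})"
          by (rule DERIV_cong) (simp add: algebra_simps)
      qed
      then show ?thesis using y0 by (simp add: prob_simplex_def)
    qed
    ultimately show ?thesis by (simp add: prob_simplex_def)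
  qed
  show ?thesis
    by (intro exI conjI ballI allI impI, rule F_lip, erule F_eq, rule F_inv) auto
qed

text \<open>Nonnegativity is part of \<open>fluid_domain\<close>, so only the total mass is at
  stake, and it is conserved. Every competitor in the uniqueness claim is thereby confined to the
  set on which the extended field equals the original one.\<close>

lemma solution_in_prob_simplex:
  assumes sol: "solves_ode_from (field gam) (fluid_domain g) y0 z"
    and "y0 \<in> prob_simplex" and t: "0 \<le> t"
  shows "z t \<in> prob_simplex"
proof -
  have "(\<Sum>k\<in>UNIV. z t $ k) = (\<Sum>k\<in>UNIV. z 0 $ k)"
  proof (rule has_real_derivative_zero_imp_eq[OF _ t, where e = "\<lambda>t. \<Sum>k\<in>UNIV. z t $ k"])
    fix s :: real assume s: "0 \<le> s"
    then have "(z has_vector_derivative field gam (z s)) (at s within {0..})"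
      using sol by (simp add: solves_ode_from_def)
    from DERIV_cong[OF DERIV_sum[OF has_vector_derivative_vec_nth[OF this]] sum_field]
    show "((\<lambda>t. \<Sum>k\<in>UNIV. z t $ k) has_real_derivative 0) (at s within {0..})" .
  qed
  moreover have "z 0 = y0" "z t \<in> fluid_domain g" using sol t by (auto simp: solves_ode_from_def)
  ultimately show ?thesis
    using assms(2) unfolding prob_simplex_def fluid_domain_def by auto
qed

section \<open>Drift and infinitesimal variance of the fleet\<close>

lemma scooter_rate_sum:
  fixes \<phi> :: "(real, 'k) vec \<Rightarrow> 'b::real_vector"
  assumes fin: "finite (scooter_states N :: ((real, 'k) vec) set)"
    and N: "1 \<le> N" and x: "x \<in> scooter_states N"
  shows "(\<Sum>z\<in>scooter_states N - {x}. scooter_rate lam mu KU g p Nst N x z *\<^sub>R \<phi> (z - x))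
    = (\<Sum>k | k \<noteq> last_interval. (lam * Nst * (x $ k * g k) / weight x)
          *\<^sub>R \<phi> ((1 / real N) *\<^sub>R (axis last_interval 1 - axis k 1)))
      + (\<Sum>k\<in>UNIV. \<Sum>j | j < k. (mu * real N * p k j * x $ k * of_bool (KU \<le> k))
          *\<^sub>R \<phi> ((1 / real N) *\<^sub>R (axis j 1 - axis k 1)))"
proof -
  \<comment> \<open>Each summand of \<open>scooter_rate\<close> is a rate to a single target and
    contains the factor \<open>x $ k\<close>; a nonzero rate therefore means that a scooter is there
    to move, and the target is a state.\<close>
  have point: "(\<Sum>z\<in>scooter_states N - {x}. (if z = x + (1 / real N) *\<^sub>R (axis i 1 - axis k 1) then r else 0) *\<^sub>R \<phi> (z - x))
      = r *\<^sub>R \<phi> ((1 / real N) *\<^sub>R (axis i 1 - axis k 1))"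
    if "i \<noteq> k" and "r \<noteq> 0 \<Longrightarrow> x $ k \<noteq> 0" for i k r
  proof (rule sum_point_mass_rate[OF fin])
    have "((1 / real N) *\<^sub>R (axis i 1 - axis k 1 :: (real, 'k) vec)) $ i \<noteq> 0"
      using that(1) N by (simp add: axis_def)
    then show "(1 / real N) *\<^sub>R (axis i 1 - axis k 1 :: (real, 'k) vec) \<noteq> 0" by force
    show "x + (1 / real N) *\<^sub>R (axis i 1 - axis k 1) \<in> scooter_states N" if "r \<noteq> 0"
      using scooter_states_jump[OF x] \<open>r \<noteq> 0 \<Longrightarrow> x $ k \<noteq> 0\<close> that \<open>i \<noteq> k\<close> by blast
  qed
  let ?S = "scooter_states N - {x}"
  have swaps: "(\<Sum>z\<in>?S. \<Sum>k | k \<noteq> last_interval.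
      (if z = x + (1 / real N) *\<^sub>R (axis last_interval 1 - axis k 1)
        then lam * Nst * (x $ k * g k) / weight x else 0) *\<^sub>R \<phi> (z - x))
    = (\<Sum>k | k \<noteq> last_interval. (lam * Nst * (x $ k * g k) / weight x)
          *\<^sub>R \<phi> ((1 / real N) *\<^sub>R (axis last_interval 1 - axis k 1)))"
    by (subst sum.swap, rule sum.cong[OF refl], rule point) auto
  have rides: "(\<Sum>z\<in>?S. \<Sum>k\<in>UNIV. \<Sum>j | j < k.
      (if z = x + (1 / real N) *\<^sub>R (axis j 1 - axis k 1)
        then mu * real N * p k j * x $ k * of_bool (KU \<le> k) else 0) *\<^sub>R \<phi> (z - x))
    = (\<Sum>k\<in>UNIV. \<Sum>j | j < k. (mu * real N * p k j * x $ k * of_bool (KU \<le> k))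
          *\<^sub>R \<phi> ((1 / real N) *\<^sub>R (axis j 1 - axis k 1)))"
    by (subst sum.swap, rule sum.cong[OF refl], subst sum.swap, rule sum.cong[OF refl], rule point) auto
  show ?thesis
    unfolding swaps[symmetric] rides[symmetric] scooter_rate_def weight_def[symmetric]
    by (simp only: scaleR_add_left sum.distrib scaleR_sum_left)
qed

text \<open>The jump size \<open>1 / real N\<close> turns \<open>Nst\<close> into
  \<open>Nst / real N\<close> and cancels the \<open>N\<close> in the ride rates. The indices
  \<open>k = last_interval\<close> and \<open>j = k\<close>, absent from the jump sums, belong to
  zero vectors, so adding them produces the sums of the field.\<close>

lemma scooter_drift:
  assumes fin: "finite (scooter_states N :: ((real, 'k) vec) set)"
    and N: "1 \<le> N" and x: "x \<in> scooter_states N"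
  shows "(\<Sum>z\<in>scooter_states N - {x}. scooter_rate lam mu KU g p Nst N x z *\<^sub>R (z - x))
    = field (Nst / real N) x"
proof -
  have "(\<Sum>k | k \<noteq> last_interval. (lam * Nst * (x $ k * g k) / weight x)
          *\<^sub>R ((1 / real N) *\<^sub>R (axis last_interval 1 - axis k 1 :: (real, 'k) vec)))
      = (\<Sum>k\<in>UNIV. (lam * (Nst / real N)) *\<^sub>R ((x $ k * g k / weight x) *\<^sub>R (axis last_interval 1 - axis k 1)))"
    by (rule sum.mono_neutral_cong_left) auto
  moreover have "(\<Sum>j | j < k. (mu * real N * p k j * x $ k * of_bool (KU \<le> k))
          *\<^sub>R ((1 / real N) *\<^sub>R (axis j 1 - axis k 1 :: (real, 'k) vec))) = x $ k *\<^sub>R ride_drift k" for k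
    unfolding ride_drift_def scaleR_sum_right
    by (rule sum.mono_neutral_cong_left) (use N in auto)
  ultimately show ?thesis
    using scooter_rate_sum[OF fin N x, of Nst "\<lambda>v. v"] by (simp only: field_split scaleR_sum_right add.commute)
qed

text \<open>A squared jump is at most \<open>4 / (real N)\<^sup>2\<close>, and the total rate is at
  most \<open>lam * Nst + mu * real N\<close>: the shares sum to 1, and so do the rows of
  \<open>p\<close> from \<open>KU\<close> on and the coordinates of \<open>x\<close>.\<close>

lemma scooter_variance:
  assumes fin: "finite (scooter_states N :: ((real, 'k) vec) set)"
    and N: "1 \<le> N" and x: "x \<in> scooter_states N" and "0 \<le> Nst"
  shows "(\<Sum>z\<in>scooter_states N - {x}. scooter_rate lam mu KU g p Nst N x z * (norm (z - x))\<^sup>2)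
    \<le> (lam * (Nst / real N) + mu) * (4 / real N)"
proof -
  have xs: "x \<in> prob_simplex" using x scooter_states_subset_prob_simplex by blast
  have x0: "0 \<le> x $ k" for k using xs by (simp add: prob_simplex_def)
  have w: "0 < weight x" by (rule weight_pos[OF xs])
  have jump: "(norm ((1 / real N) *\<^sub>R (axis i 1 - axis k 1 :: (real, 'k) vec)))\<^sup>2 \<le> 4 / (real N)\<^sup>2" for i k
    using power_mono[OF norm_axis_diff_le[of i k] norm_ge_zero, of 2]
    by (simp add: power_divide divide_right_mono)
  have rate1: "0 \<le> lam * Nst * (x $ k * g k) / weight x" for k
    using lam \<open>0 \<le> Nst\<close> x0 less_imp_le[OF g_pos] w by simp
  have rate2: "0 \<le> mu * real N * p k j * x $ k * of_bool (KU \<le> k)" if "j < k" for k j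
    using mu x0 p_nonneg[of j k] that by simp
  have "(\<Sum>z\<in>scooter_states N - {x}. scooter_rate lam mu KU g p Nst N x z *\<^sub>R (norm (z - x))\<^sup>2)
    \<le> (\<Sum>k | k \<noteq> last_interval. (lam * Nst * (x $ k * g k) / weight x) * (4 / (real N)\<^sup>2))
      + (\<Sum>k\<in>UNIV. \<Sum>j | j < k. (mu * real N * p k j * x $ k * of_bool (KU \<le> k)) * (4 / (real N)\<^sup>2))"
    unfolding scooter_rate_sum[OF fin N x, of Nst "\<lambda>v. (norm v)\<^sup>2"]
    unfolding real_scaleR_def
    using rate1 rate2 jump by (intro add_mono sum_mono mult_left_mono) auto
  also have "\<dots> = ((\<Sum>k | k \<noteq> last_interval. lam * Nst * (x $ k * g k) / weight x)
      + (\<Sum>k\<in>UNIV. \<Sum>j | j < k. mu * real N * p k j * x $ k * of_bool (KU \<le> k))) * (4 / (real N)\<^sup>2)"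
    by (simp only: distrib_right sum_distrib_right)
  also have "\<dots> \<le> (lam * Nst + mu * real N) * (4 / (real N)\<^sup>2)"
  proof (intro mult_right_mono add_mono)
    have "(\<Sum>k | k \<noteq> last_interval. lam * Nst * (x $ k * g k) / weight x)
        \<le> (\<Sum>k\<in>UNIV. lam * Nst * (x $ k * g k) / weight x)"
      by (rule sum_mono2) (use rate1 in auto)
    also have "\<dots> = lam * Nst * weight x / weight x"
      by (simp only: weight_def sum_divide_distrib sum_distrib_left)
    finally show "(\<Sum>k | k \<noteq> last_interval. lam * Nst * (x $ k * g k) / weight x) \<le> lam * Nst"
      using w by simp
    have "(\<Sum>j | j < k. mu * real N * p k j * x $ k * of_bool (KU \<le> k)) \<le> mu * real N * x $ k" for k
    proof (cases "KU \<le> k")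
      case True
      have "(\<Sum>j | j < k. p k j) \<le> (\<Sum>j\<le>k. p k j)"
        by (rule sum_mono2) (use p_nonneg in auto)
      then have "mu * real N * x $ k * (\<Sum>j | j < k. p k j) \<le> mu * real N * x $ k * 1"
        using p_sum[OF True] mu x0 by (intro mult_left_mono) auto
      then show ?thesis using True by (simp add: sum_distrib_left mult_ac)
    qed (use mu x0 in simp)
    then have "(\<Sum>k\<in>UNIV. \<Sum>j | j < k. mu * real N * p k j * x $ k * of_bool (KU \<le> k))
        \<le> (\<Sum>k\<in>UNIV. mu * real N * x $ k)" by (rule sum_mono)
    also have "\<dots> = mu * real N" using xs by (simp add: prob_simplex_def flip: sum_distrib_left)
    finally show "(\<Sum>k\<in>UNIV. \<Sum>j | j < k. mu * real N * p k j * x $ k * of_bool (KU \<le> k)) \<le> mu * real N" .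
  qed simp
  also have "\<dots> = (lam * (Nst / real N) + mu) * (4 / real N)"
    using N by (simp add: field_simps power2_eq_square)
  finally show ?thesis by simp
qed

end

section \<open>Well-posedness of the limit equation and convergence\<close>

lemma (in escooter_fleet) solution_exists_unique:
  assumes "0 \<le> gam" and y0: "y0 \<in> prob_simplex"
  shows "\<exists>y F L. solves_ode_from (field gam) (fluid_domain g) y0 y \<and>
    (\<forall>z. solves_ode_from (field gam) (fluid_domain g) y0 z \<longrightarrow> (\<forall>t\<ge>0. z t = y t)) \<and>
    L-lipschitz_on UNIV F \<and> (\<forall>x\<in>prob_simplex. F x = field gam x)"
proof -
  \<comment> \<open>\<open>F\<close> is passed on to the conclusion together with \<open>y\<close>,
    because the deviation estimate works with a field that is Lipschitz on the whole space.\<close>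
  obtain F L where lip: "L-lipschitz_on UNIV F"
    and F: "\<forall>x\<in>prob_simplex. F x = field gam x"
    and inv: "\<forall>y. (\<forall>t\<ge>0. (y has_vector_derivative F (y t)) (at t within {0..}))
      \<longrightarrow> y 0 \<in> prob_simplex \<longrightarrow> (\<forall>t\<ge>0. y t \<in> prob_simplex)"
    using field_extension[OF assms(1)] by (elim exE conjE)
  obtain y where init: "y 0 = y0"
    and y: "\<forall>t\<ge>0. (y has_vector_derivative F (y t)) (at t within {0..})"
    using lipschitz_ode_solution_exists[OF lip, of y0] by (elim exE conjE)
  have yS: "y t \<in> prob_simplex" if "0 \<le> t" for t
    using inv[rule_format, of y, OF y[rule_format] _ that] init y0 by simp
  have "solves_ode_from (field gam) (fluid_domain g) y0 y"
    unfolding solves_ode_from_def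
  proof (intro conjI allI impI)
    fix t :: real assume t: "0 \<le> t"
    show "y t \<in> fluid_domain g" by (rule subsetD[OF prob_simplex_subset_fluid_domain yS[OF t]])
    show "(y has_vector_derivative field gam (y t)) (at t within {0..})"
      using y[rule_format, OF t] unfolding bspec[OF F yS[OF t]] .
  qed (rule init)
  moreover have "z t = y t"
    if z: "solves_ode_from (field gam) (fluid_domain g) y0 z" and "0 \<le> t" for z t
  proof (rule lipschitz_ode_solution_unique[OF lip y[rule_format] _ _ \<open>0 \<le> t\<close>])
    fix s :: real assume s: "0 \<le> s"
    show "(z has_vector_derivative F (z s)) (at s within {0..})"
      using z s unfolding bspec[OF F solution_in_prob_simplex[OF z y0 s]] by (simp add: solves_ode_from_def)
  qed (use z init in \<open>simp_all add: solves_ode_from_def\<close>)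
  ultimately show ?thesis using lip F by (intro exI conjI allI impI) auto
qed

text \<open>If \<open>y0\<close> had a positive distance to \<open>D\<close>, every
  \<open>X N\<close> with \<open>N \<ge> 1\<close> would stay away from \<open>y0\<close> with
  probability 1. This is how the initial point is known to lie in the simplex.\<close>

lemma closed_limit_in_probability:
  fixes y0 :: "'a::real_normed_vector" and X :: "nat \<Rightarrow> 'w \<Rightarrow> 'a"
  assumes "closed D" and prob: "\<And>N. 1 \<le> N \<Longrightarrow> prob_space (M N)"
    and X: "\<And>N \<omega>. 1 \<le> N \<Longrightarrow> \<omega> \<in> space (M N) \<Longrightarrow> X N \<omega> \<in> D"
    and lim: "\<And>e. 0 < e \<Longrightarrow>
      (\<lambda>N. measure (M N) {\<omega> \<in> space (M N). e < norm (X N \<omega> - y0)}) \<longlonglongrightarrow> 0"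
  shows "y0 \<in> D"
proof (rule ccontr)
  assume "y0 \<notin> D"
  then obtain e where e: "0 < e" "\<And>x. norm (x - y0) < e \<Longrightarrow> x \<notin> D"
    using \<open>closed D\<close> unfolding closed_def open_dist by (auto simp: dist_norm)
  have "\<forall>\<^sub>F N in sequentially. measure (M N) {\<omega> \<in> space (M N). e / 2 < norm (X N \<omega> - y0)} = 1"
    using eventually_ge_at_top[of 1]
  proof eventually_elim
    case (elim N)
    have "e / 2 < norm (X N \<omega> - y0)" if "\<omega> \<in> space (M N)" for \<omega>
      using e(2)[of "X N \<omega>"] X[OF elim that] e(1) by force
    then have "{\<omega> \<in> space (M N). e / 2 < norm (X N \<omega> - y0)} = space (M N)" by blast
    then show ?case using prob_space.prob_space[OF prob[OF elim]] by simp
  qed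
  then have "(\<lambda>N. measure (M N) {\<omega> \<in> space (M N). e / 2 < norm (X N \<omega> - y0)}) \<longlonglongrightarrow> 1"
    by (rule tendsto_eventually)
  with lim[of "e / 2"] e(1) show False by (auto dest: LIMSEQ_unique)
qed

theorem theorem4p1:
  fixes lam mu gam :: real
    and KU :: "'k::{finite,linorder}"
    and g :: "'k \<Rightarrow> real"
    and p :: "'k \<Rightarrow> 'k \<Rightarrow> real"
    and Nst :: "nat \<Rightarrow> real"
    and M :: "nat \<Rightarrow> 'w measure"
    and Y :: "nat \<Rightarrow> real \<Rightarrow> 'w \<Rightarrow> real ^ 'k::{finite,linorder}"
    and y0 :: "real ^ 'k::{finite,linorder}"
  assumes "lam > 0" and "mu > 0" and "gam \<ge> 0"
    and "antimono g" and "\<And>k. g k > 0"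
    and "\<And>i j. j \<le> i \<Longrightarrow> p i j \<ge> 0"
    and "\<And>i j. i < j \<Longrightarrow> p i j = 0"
    and "\<And>i. KU \<le> i \<Longrightarrow> (\<Sum>j\<le>i. p i j) = 1"
    and "\<And>N. N \<ge> 1 \<Longrightarrow> Nst N \<ge> 0"
    and "\<And>N. N \<ge> 1 \<Longrightarrow>
           markov_jump_process (M N) (scooter_states N)
             (scooter_rate lam mu KU g p (Nst N) N) (Y N)"
    and "(\<lambda>N. Nst N / real N) \<longlonglongrightarrow> gam"
    and "\<And>e. e > 0 \<Longrightarrow>
           (\<lambda>N. measure (M N) {\<omega> \<in> space (M N). norm (Y N 0 \<omega> - y0) > e}) \<longlonglongrightarrow> 0"
  shows "(\<forall>y \<in> fluid_domain g. \<forall>j.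
            fluid_field lam mu KU g p gam y $ j =
              (\<Sum>k\<in>{max KU j..}. mu * p k j * y $ k) + lam * gam * of_bool (j = last_interval)
              - mu * y $ j * of_bool (KU \<le> j)
              - lam * gam * y $ j * g j / (\<Sum>i\<in>UNIV. y $ i * g i))
       \<and> (\<exists>y. solves_ode_from (fluid_field lam mu KU g p gam) (fluid_domain g) y0 y
            \<and> (\<forall>z. solves_ode_from (fluid_field lam mu KU g p gam) (fluid_domain g) y0 z
                  \<longrightarrow> (\<forall>t\<ge>0. z t = y t))
            \<and> (\<forall>t0>0. \<forall>\<epsilon>>0.
                 (\<lambda>N. measure (M N)
                    {\<omega> \<in> space (M N). (SUP t\<in>{0..t0}. norm (Y N t \<omega> - y t)) > \<epsilon>})
                 \<longlonglongrightarrow> 0))"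
proof -
  note lam = assms(1) and mu = assms(2) and gam = assms(3) and g = assms(5)
    and p = assms(6-8) and Nst = assms(9) and mjp = assms(10) and Nst_lim = assms(11) and init_lim = assms(12)
  interpret escooter_fleet lam mu KU g p
    by unfold_locales (fact lam mu g p)+
  have prob: "prob_space (M N)" if "1 \<le> N" for N
    using mjp[OF that] by (simp add: markov_jump_process_def)
  have fin: "finite (scooter_states N :: ((real, 'k) vec) set)" if "1 \<le> N" for N
    using mjp[OF that] unfolding markov_jump_process_def transition_semigroup_with_rates_def by blast
  have Y_states: "Y N 0 \<omega> \<in> scooter_states N" if "1 \<le> N" "\<omega> \<in> space (M N)" for N \<omega>
    using mjp[OF that(1)] that(2) unfolding markov_jump_process_def
    by (metis measurable_space order_refl space_count_space)
  have y0: "y0 \<in> prob_simplex"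
    by (rule closed_limit_in_probability[where M = M and X = "\<lambda>N. Y N 0",
          OF closed_prob_simplex prob])
      (use Y_states scooter_states_subset_prob_simplex init_lim in auto)
  obtain y F L where sol: "solves_ode_from (field gam) (fluid_domain g) y0 y"
    and uniq: "\<forall>z. solves_ode_from (field gam) (fluid_domain g) y0 z \<longrightarrow> (\<forall>t\<ge>0. z t = y t)"
    and lip: "L-lipschitz_on UNIV F" and F': "\<forall>x\<in>prob_simplex. F x = field gam x"
    using solution_exists_unique[OF gam y0] by (elim exE conjE)
  note F = F'[rule_format]
  have yS: "y t \<in> prob_simplex" if "0 \<le> t" for t
    by (rule solution_in_prob_simplex[OF sol y0 that])
  have y_init: "y 0 = y0" using sol by (simp add: solves_ode_from_def)
  define d where "d N = 2 * lam * \<bar>Nst N / real N - gam\<bar>" for N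
  define v where "v N = (lam * (Nst N / real N) + mu) * (4 / real N)" for N
  \<comment> \<open>Points of the simplex have norm at most 1, whence \<open>norm (F 0) + L\<close>
    bounds \<open>F\<close> along \<open>y\<close> and 2 bounds the distance from any state to
    \<open>y t\<close>.\<close>
  have near: "markov_jump_near_ode (M N) (scooter_states N) (scooter_rate lam mu KU g p (Nst N) N)
      (Y N) F y L (norm (F 0) + L) 2 (d N) (v N)" if N: "1 \<le> N" for N
  proof
    show "markov_jump_process (M N) (scooter_states N) (scooter_rate lam mu KU g p (Nst N) N) (Y N)"
      by (rule mjp[OF N])
    show "L-lipschitz_on UNIV F" by (rule lip)
    show "(y has_vector_derivative F (y t)) (at t within {0..})" if "0 \<le> t" for t
      using sol that F[OF yS[OF that]] by (simp add: solves_ode_from_def)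
    show "norm (F (y t)) \<le> norm (F 0) + L" if "0 \<le> t" for t
    proof -
      have "norm (F (y t)) \<le> norm (F 0) + norm (F (y t) - F 0)" by (rule norm_triangle_sub)
      also have "norm (F (y t) - F 0) \<le> L * norm (y t)"
        using lipschitz_onD[OF lip, of "y t" 0] by (simp add: dist_norm)
      also have "L * norm (y t) \<le> L * 1"
        using norm_prob_simplex_le_1[OF yS[OF that]] lipschitz_on_nonneg[OF lip] by (rule mult_left_mono)
      finally show ?thesis by simp
    qed
    fix x :: "(real, 'k) vec" assume x: "x \<in> scooter_states N"
    then have xS: "x \<in> prob_simplex" using scooter_states_subset_prob_simplex by blast
    show "norm (x - y t) \<le> 2" if "0 \<le> t" for t
      using norm_triangle_ineq4[of x "y t"] norm_prob_simplex_le_1[OF xS] norm_prob_simplex_le_1[OF yS[OF that]]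
      by linarith
    show "norm ((\<Sum>z\<in>scooter_states N - {x}. scooter_rate lam mu KU g p (Nst N) N x z *\<^sub>R (z - x)) - F x) \<le> d N"
      using norm_field_diff_le[OF xS, of "Nst N / real N" gam]
      unfolding scooter_drift[OF fin[OF N] N x] F[OF xS] d_def .
    show "(\<Sum>z\<in>scooter_states N - {x}. scooter_rate lam mu KU g p (Nst N) N x z * (norm (z - x))\<^sup>2) \<le> v N"
      using scooter_variance[OF fin[OF N] N x Nst[OF N]] unfolding v_def .
  qed
  have d_lim: "d \<longlonglongrightarrow> 0"
    unfolding d_def using tendsto_mult[OF tendsto_const[of "2 * lam"] tendsto_rabs[OF tendsto_diff[OF Nst_lim tendsto_const[of gam]]]]
    by simp
  have "(\<lambda>N. 4 / real N) \<longlonglongrightarrow> 0" by (rule lim_const_over_n)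
  then have v_lim: "v \<longlonglongrightarrow> 0"
    unfolding v_def using tendsto_mult[OF tendsto_add[OF tendsto_mult[OF tendsto_const[of lam] Nst_lim] tendsto_const[of mu]]]
    by fastforce
  have v0: "0 \<le> v N" if "1 \<le> N" for N
    using lam mu Nst[OF that] by (simp add: v_def)
  have conv: "(\<lambda>N. measure (M N)
      {\<omega> \<in> space (M N). (SUP t\<in>{0..t0}. norm (Y N t \<omega> - y t)) > \<epsilon>}) \<longlonglongrightarrow> 0"
    if t0: "0 < t0" and \<epsilon>: "0 < \<epsilon>" for t0 \<epsilon>
  proof (rule order_tendstoI)
    define c where "c = exp (2 * L * t0) / \<epsilon>\<^sup>2"
    have c: "0 < c" using \<epsilon> by (simp add: c_def)
    fix \<eta> :: real assume \<eta>: "0 < \<eta>"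
    \<comment> \<open>With this radius the initial deviation contributes \<open>\<eta> / 2\<close>;
      the other terms vanish as \<open>N\<close> grows, so the bound falls below
      \<open>\<eta>\<close>.\<close>
    define r where "r = sqrt (\<eta> / (2 * c))"
    have r: "0 < r" "r\<^sup>2 * c = \<eta> / 2" using \<eta> c by (auto simp: r_def)
    have "(\<lambda>N. measure (M N) {\<omega> \<in> space (M N). r < norm (Y N 0 \<omega> - y0)}
        + (r\<^sup>2 + t0 * (2 * 2 * d N + v N)) * c) \<longlonglongrightarrow> 0 + (r\<^sup>2 + t0 * (2 * 2 * 0 + 0)) * c"
      by (intro tendsto_intros init_lim r d_lim v_lim)
    moreover have "0 + (r\<^sup>2 + t0 * (2 * 2 * 0 + 0)) * c < \<eta>" using r \<eta> by simp
    ultimately have "\<forall>\<^sub>F N in sequentially. measure (M N) {\<omega> \<in> space (M N). r < norm (Y N 0 \<omega> - y0)}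
        + (r\<^sup>2 + t0 * (2 * 2 * d N + v N)) * c < \<eta>"
      by (rule order_tendstoD)
    then show "\<forall>\<^sub>F N in sequentially. measure (M N)
        {\<omega> \<in> space (M N). (SUP t\<in>{0..t0}. norm (Y N t \<omega> - y t)) > \<epsilon>} < \<eta>"
      using eventually_ge_at_top[of 1]
    proof eventually_elim
      case (elim N)
      from markov_jump_near_ode.sup_deviation_bound[OF near[OF elim(2)] t0 \<epsilon> less_imp_le[OF r(1)] v0[OF elim(2)]] elim(1)
      show ?case by (simp add: y_init c_def)
    qed
  qed (simp add: order.strict_trans2[OF _ measure_nonneg])
  have comp: "\<forall>y \<in> fluid_domain g. \<forall>j. field gam y $ j =
      (\<Sum>k\<in>{max KU j..}. mu * p k j * y $ k) + lam * gam * of_bool (j = last_interval)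
      - mu * y $ j * of_bool (KU \<le> j) - lam * gam * y $ j * g j / (\<Sum>i\<in>UNIV. y $ i * g i)"
    using field_component by (simp add: fluid_domain_def weight_def)
  show ?thesis
    by (intro conjI exI[of _ y] allI impI comp sol uniq conv)
qed

end
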